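(* Let $n=2k$ be an even integer with $k\ge 2$, let $K$ be a field of characteristic $2$, let $X=(x_{ij})_{1\le i,j\le n}$ and $Y=(y_{ij})_{1\le i,j\le n}$ be matrices of independent indeterminates over $K$, let $R=K[X,Y]$ be the polynomial ring in all these $2n^2$ variables, and let $C=XY-YX=(c_{ij})$. Let $\mathcal{I}$ be the ideal of $R$ generated by all diagonal entries $c_{ii}$ and all anti-diagonal entries $c_{i,n+1-i}$ ($1\le i\le n$) of $C$. Let $$\Omega_2=\{(i,j): 1\le i\le k-1,\ 1\le j\le 2k\}\cup\{(k,j): k-1\le j\le k+1\}\cup\{(k+1,k+1),(k+2,k+2)\}$$ $$\cup\,\{(k+1,j): k+3\le j\le 2k\}\cup\{(k+2,j): 1\le j\le k-2\}\cup\{(k+2,j): k+2\le j\le 2k\}$$ $$\cup\,\{(i,j): k+3\le i\le 2k,\ 1\le j\le k-1\}\cup\{(i,j): k+3\le i\le 2k,\ k+1\le j\le 2k\}.$$ Then the elements $$x_{ij},\ y_{ji}\quad\text{with }(i,j)\in\Omega_2,$$ $$x_{k,s}-y_{2k+1-s,k}\quad\text{with }1\le s\le k-2\text{ and with }k+3\le s\le 2k,$$ $$x_{k+1,s}-y_{s,k+1}\quad\text{with }1\le s\le k-2,$$ $$x_{s,k}-y_{k,s}\quad\text{with }k+3\le s\le 2k,$$ $$x_{k,k+2}-y_{k+2,k},\quad x_{k+1,k-1}-y_{k+2,k+1},\quad x_{k+1,k}-y_{k,k+1},\quad x_{k+1,k+2}-y_{k-1,k+1},$$ $$x_{k+2,k-1}-y_{k-1,k+2},\quad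 x_{k+2,k}-y_{k+1,k+2},\quad x_{k+2,k+1}-y_{k,k+2}$$ form a homogeneous system of parameters for $R/\mathcal{I}$.
   Context: $R$ is graded by total degree with all variables of degree $1$. A homogeneous system of parameters for a quotient $R/\mathfrak a$ by a homogeneous ideal $\mathfrak a$ is a sequence of $\dim(R/\mathfrak a)$ homogeneous elements of positive degree such that the quotient of $R/\mathfrak a$ by the ideal they generate has Krull dimension $0$ (equivalently, together with $\mathfrak a$ they generate an ideal primary to the homogeneous maximal ideal of $R$). *)

theory Defs
  imports
    "HOL-Algebra.QuotRing"
    "HOL-Library.Poly_Mapping"
    "HOL-Library.Extended_Real"
begin

section \<open>Krull dimension\<close>

text \<open>
  The supremum of the lengths \<open>m\<close> of chains \<open>P 0 \<subset> \<dots> \<subset> P m\<close> of prime ideals. The zero ring has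
  no prime ideals and hence dimension \<open>-\<infinity>\<close>; in particular it does not have dimension \<open>0\<close>.
\<close>

definition krull_dim :: "('b, 'c) ring_scheme \<Rightarrow> ereal" where
  "krull_dim R = Sup {ereal (real m) | m.
     \<exists>P :: nat \<Rightarrow> 'b set. (\<forall>i\<le>m. primeideal (P i) R) \<and> (\<forall>i<m. P i \<subset> P (Suc i))}"


section \<open>Polynomial rings in a set of variables\<close>

text \<open>
  A monomial is a finitely supported exponent function, a polynomial a finitely supported
  coefficient function on monomials. The number of variables depends on a natural number, so the
  polynomial ring in the variables \<open>V\<close> is a carrier inside the type of polynomials in all
  variables of type \<open>'v\<close>.
\<close>

type_synonym ('v, 'a) mpoly = "('v \<Rightarrow>\<^sub>0 nat) \<Rightarrow>\<^sub>0 'a"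

definition mpoly_ring :: "'v set \<Rightarrow> ('v, 'a::comm_ring_1) mpoly ring" where
  "mpoly_ring V = \<lparr>carrier = {p. \<forall>m\<in>Poly_Mapping.keys p. Poly_Mapping.keys m \<subseteq> V},
     mult = (*), one = 1, zero = 0, add = (+)\<rparr>"

lemma cring_mpoly_ring: "cring (mpoly_ring V :: ('v, 'a::comm_ring_1) mpoly ring)"
proof -
  define S where "S = {p :: ('v, 'a) mpoly. \<forall>m\<in>Poly_Mapping.keys p. Poly_Mapping.keys m \<subseteq> V}"
  have R: "mpoly_ring V = \<lparr>carrier = S, mult = (*), one = 1, zero = 0, add = (+)\<rparr>"
    by (simp add: mpoly_ring_def S_def)
  have uminus: "- p \<in> S" if "p \<in> S" for p
    using that by (simp add: S_def in_keys_iff)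
  have add: "p + q \<in> S" if "p \<in> S" "q \<in> S" for p q
    using that keys_add[of p q] unfolding S_def by blast
  have mult: "p * q \<in> S" if pq: "p \<in> S" "q \<in> S" for p q
    unfolding S_def
  proof (intro CollectI ballI)
    fix m assume "m \<in> Poly_Mapping.keys (p * q)"
    then obtain a b where "m = a + b" "a \<in> Poly_Mapping.keys p" "b \<in> Poly_Mapping.keys q"
      using keys_mult[of p q] by blast
    then show "Poly_Mapping.keys m \<subseteq> V"
      using pq keys_add[of a b] unfolding S_def by blast
  qed
  have "0 \<in> S" "1 \<in> S"
    by (simp_all add: S_def)
  moreover have "\<exists>q\<in>S. q + p = 0" if "p \<in> S" for p
    using uminus[OF that] by (intro bexI[of _ "- p"]) simp_all
  ultimately show ?thesis
    unfolding R using add mult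
    by (intro cringI abelian_groupI comm_monoidI) (simp_all add: algebra_simps)
qed

definition mvar :: "'v \<Rightarrow> ('v, 'a::comm_ring_1) mpoly" where
  "mvar v = Poly_Mapping.single (Poly_Mapping.single v 1) 1"

definition mdeg :: "('v \<Rightarrow>\<^sub>0 nat) \<Rightarrow> nat" where
  "mdeg m = (\<Sum>v\<in>Poly_Mapping.keys m. Poly_Mapping.lookup m v)"

definition homogeneous :: "nat \<Rightarrow> ('v, 'a::comm_ring_1) mpoly \<Rightarrow> bool" where
  "homogeneous d p \<longleftrightarrow> (\<forall>m\<in>Poly_Mapping.keys p. mdeg m = d)"

definition homogeneous_ideal :: "'v set \<Rightarrow> ('v, 'a::comm_ring_1) mpoly set \<Rightarrow> bool" where
  "homogeneous_ideal V \<aa> \<longleftrightarrow>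
     (\<exists>S \<subseteq> carrier (mpoly_ring V). (\<forall>p\<in>S. \<exists>d. homogeneous d p) \<and> \<aa> = Idl\<^bsub>mpoly_ring V\<^esub> S)"

text \<open>
  The sequence \<open>ws\<close> consists of elements of \<open>R/\<aa>\<close>, i.e. of cosets, where \<open>R\<close> is the polynomial
  ring in the variables \<open>V\<close>. The homogeneous elements of \<open>R/\<aa>\<close> of degree \<open>d\<close> are the classes of
  the homogeneous polynomials of degree \<open>d\<close>.
\<close>

definition hsop :: "'v set \<Rightarrow> ('v, 'a::comm_ring_1) mpoly set \<Rightarrow> ('v, 'a) mpoly set list \<Rightarrow> bool" where
  "hsop V \<aa> ws \<longleftrightarrow>
     (let R = mpoly_ring V; A = R Quot \<aa> in
        homogeneous_ideal V \<aa> \<and>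
        (\<forall>w\<in>set ws. \<exists>d>0. \<exists>f\<in>carrier R. homogeneous d f \<and> w = \<aa> +>\<^bsub>R\<^esub> f) \<and>
        ereal (real (length ws)) = krull_dim A \<and>
        krull_dim (A Quot (Idl\<^bsub>A\<^esub> (set ws))) = 0)"


section \<open>Two generic matrices\<close>

datatype mat_var = XVar nat nat | YVar nat nat

type_synonym 'a mat_poly = "(mat_var, 'a) mpoly"

definition mat_vars :: "nat \<Rightarrow> mat_var set" where
  "mat_vars n = {XVar i j | i j. i \<in> {1..n} \<and> j \<in> {1..n}} \<union> {YVar i j | i j. i \<in> {1..n} \<and> j \<in> {1..n}}"

definition vx :: "nat \<Rightarrow> nat \<Rightarrow> 'a::comm_ring_1 mat_poly" where
  "vx i j = mvar (XVar i j)"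

definition vy :: "nat \<Rightarrow> nat \<Rightarrow> 'a::comm_ring_1 mat_poly" where
  "vy i j = mvar (YVar i j)"

text \<open>The \<open>(i,j)\<close> entry of \<open>C = XY - YX\<close> for \<open>n \<times> n\<close> matrices.\<close>

definition comm_entry :: "nat \<Rightarrow> nat \<Rightarrow> nat \<Rightarrow> 'a::comm_ring_1 mat_poly" where
  "comm_entry n i j = (\<Sum>l=1..n. vx i l * vy l j) - (\<Sum>l=1..n. vy i l * vx l j)"

definition diag_antidiag_ideal :: "nat \<Rightarrow> 'a::comm_ring_1 mat_poly set" where
  "diag_antidiag_ideal n = Idl\<^bsub>mpoly_ring (mat_vars n)\<^esub>
     ({comm_entry n i i | i. i \<in> {1..n}} \<union> {comm_entry n i (n + 1 - i) | i. i \<in> {1..n}})"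


section \<open>The parameters\<close>

definition Omega2 :: "nat \<Rightarrow> (nat \<times> nat) set" where
  "Omega2 k =
     {(i, j). 1 \<le> i \<and> i \<le> k - 1 \<and> 1 \<le> j \<and> j \<le> 2 * k} \<union>
     {(k, j) | j. k - 1 \<le> j \<and> j \<le> k + 1} \<union>
     {(k + 1, k + 1), (k + 2, k + 2)} \<union>
     {(k + 1, j) | j. k + 3 \<le> j \<and> j \<le> 2 * k} \<union>
     {(k + 2, j) | j. 1 \<le> j \<and> j \<le> k - 2} \<union>
     {(k + 2, j) | j. k + 2 \<le> j \<and> j \<le> 2 * k} \<union>
     {(i, j). k + 3 \<le> i \<and> i \<le> 2 * k \<and> 1 \<le> j \<and> j \<le> k - 1} \<union>
     {(i, j). k + 3 \<le> i \<and> i \<le> 2 * k \<and> k + 1 \<le> j \<and> j \<le> 2 * k}"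

definition parameters :: "nat \<Rightarrow> 'a::comm_ring_1 mat_poly set" where
  "parameters k =
     {vx i j | i j. (i, j) \<in> Omega2 k} \<union>
     {vy j i | i j. (i, j) \<in> Omega2 k} \<union>
     {vx k s - vy (2 * k + 1 - s) k | s. 1 \<le> s \<and> s \<le> k - 2 \<or> k + 3 \<le> s \<and> s \<le> 2 * k} \<union>
     {vx (k + 1) s - vy s (k + 1) | s. 1 \<le> s \<and> s \<le> k - 2} \<union>
     {vx s k - vy k s | s. k + 3 \<le> s \<and> s \<le> 2 * k} \<union>
     {vx k (k + 2) - vy (k + 2) k,
      vx (k + 1) (k - 1) - vy (k + 2) (k + 1),
      vx (k + 1) k - vy k (k + 1),
      vx (k + 1) (k + 2) - vy (k - 1) (k + 1),
      vx (k + 2) (k - 1) - vy (k - 1) (k + 2),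
      vx (k + 2) k - vy (k + 1) (k + 2),
      vx (k + 2) (k + 1) - vy k (k + 2)}"

lemma finite_parameters: "finite (parameters k :: 'a::comm_ring_1 mat_poly set)"
proof -
  have "Omega2 k \<subseteq> {..2 * k + 2} \<times> {..2 * k + 2}"
    by (auto simp: Omega2_def)
  then have "finite (Omega2 k)"
    by (rule finite_subset) simp
  then have img: "finite {f i j | i j. (i, j) \<in> Omega2 k}" for f :: "nat \<Rightarrow> nat \<Rightarrow> 'a mat_poly"
    by (rule finite_subset[rotated, OF finite_imageI[of _ "\<lambda>(i, j). f i j"]]) force
  have int: "finite {f s | s. P s}" if "\<And>s. P s \<Longrightarrow> s \<le> 2 * k"
    for P and f :: "nat \<Rightarrow> 'a mat_poly"
    by (rule finite_subset[of _ "f ` {..2 * k}"]) (use that in auto)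
  show ?thesis
    unfolding parameters_def
    by (intro finite_UnI img img[of "\<lambda>i j. vy j i"] int finite.insertI finite.emptyI) auto
qed

end

theory Submission
  imports Defs
begin

text \<open>
  Let \<open>R\<close> be the polynomial ring in the \<open>2 * n\<^sup>2\<close> entries of \<open>X\<close> and \<open>Y\<close>. The ideal \<open>I\<close> has
  \<open>2 * n\<close> generators, but the diagonal entries of a commutator add up to zero, so \<open>2 * n - 1\<close> of them
  suffice. The number of parameters is \<open>2 * n\<^sup>2 - (2 * n - 1)\<close>, the dimension that one expects of
  \<open>R/I\<close>. Three facts show that \<open>R/I\<close> has this dimension and that the parameters reduce it to zero.

  \<^item> All variables are nilpotent modulo \<open>I\<close> and the parameters. The parameters annihilate many variables
    and identify each of the others of \<open>X\<close> with one of \<open>Y\<close>; after this the generators of \<open>I\<close>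
    become, one after the other and modulo terms that are already nilpotent, squares of variables
    (\<open>variables_of_vanishing_parameters\<close>). So the homogeneous maximal ideal is the only prime above \<open>I\<close>
    and the parameters (\<open>krull_dim_zero_of_nilpotent_variables\<close>).

  \<^item> The dimension of \<open>R/I\<close> is at most the number of parameters (\<open>krull_dim_le_card_parameters\<close>). By
    the graded Nakayama lemma, \<open>R/I\<close> is spanned over the subalgebra of the parameters by finitely many
    monomials, and therefore its part of degree at most \<open>t\<close> has a dimension of order \<open>t ^ d\<close>, where
    \<open>d\<close> is the number of parameters. A chain of primes of length \<open>m\<close> gives \<open>m\<close> algebraically
    independent elements (\<open>prime_chain_powers_independent\<close>), and hence a growth of order at least
    \<open>t ^ m\<close>.

  \<^item> The dimension of \<open>R/I\<close> is at least \<open>2 * n\<^sup>2 - (2 * n - 1)\<close> (\<open>krull_dim_diag_antidiag_ge\<close>). The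
    generators are linear in \<open>Y\<close>. Solving this system of \<open>2 * n - 1\<close> linear equations over \<open>K[X]\<close> leaves
    at least \<open>n\<^sup>2 - (2 * n - 1)\<close> free variables of \<open>Y\<close>, and the \<open>n\<^sup>2\<close> variables of \<open>X\<close> are free as
    well. Setting the free variables to zero one by one gives a chain of primes above \<open>I\<close>
    (\<open>krull_dim_ge_of_linear_equations\<close>).
\<close>

section \<open>Homogeneous linear systems over an integral domain\<close>

text \<open>
  Gaussian elimination without denominators. The set \<open>S\<close> consists of the free unknowns, and column
  \<open>s\<close> of \<open>a\<close> is the solution in which the free unknown \<open>s\<close> has the value \<open>D\<close> and the other free
  unknowns vanish. Each equation costs at most one free unknown. Keeping the coefficients in a subring
  \<open>E\<close> makes it possible to solve equations over \<open>K[X]\<close> inside \<open>K[X, Y]\<close>; over a field the lemma is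
  the existence of a nontrivial solution when there are more unknowns than equations.
\<close>

lemma homogeneous_linear_system:
  fixes c :: "nat \<Rightarrow> 'v \<Rightarrow> 'a::idom"
  assumes V: "finite V"
    and one: "1 \<in> E" and diff: "\<And>x y. x \<in> E \<Longrightarrow> y \<in> E \<Longrightarrow> x - y \<in> E"
    and mult: "\<And>x y. x \<in> E \<Longrightarrow> y \<in> E \<Longrightarrow> x * y \<in> E"
    and c: "\<And>i v. i < r \<Longrightarrow> v \<in> V \<Longrightarrow> c i v \<in> E"
  shows "\<exists>S a D. S \<subseteq> V \<and> card V \<le> card S + r \<and> D \<in> E \<and> D \<noteq> 0 \<and>
    (\<forall>v\<in>V. \<forall>s\<in>S. a v s \<in> E) \<and>
    (\<forall>s\<in>S. \<forall>t\<in>S. a t s = (if t = s then D else 0)) \<and>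
    (\<forall>i<r. \<forall>s\<in>S. (\<Sum>v\<in>V. c i v * a v s) = 0)"
  using c
proof (induction r)
  case 0
  have zero: "0 \<in> E" using diff[OF one one] by simp
  show ?case
    by (rule exI[of _ V], rule exI[of _ "\<lambda>v s. if v = s then 1 else 0"], rule exI[of _ 1])
      (simp add: one zero)
next
  case (Suc r)
  have "\<exists>S a D. S \<subseteq> V \<and> card V \<le> card S + r \<and> D \<in> E \<and> D \<noteq> 0 \<and>
    (\<forall>v\<in>V. \<forall>s\<in>S. a v s \<in> E) \<and>
    (\<forall>s\<in>S. \<forall>t\<in>S. a t s = (if t = s then D else 0)) \<and>
    (\<forall>i<r. \<forall>s\<in>S. (\<Sum>v\<in>V. c i v * a v s) = 0)"
    by (rule Suc.IH) (simp add: Suc.prems)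
  then obtain S a D where IH0: "S \<subseteq> V \<and> card V \<le> card S + r \<and> D \<in> E \<and> D \<noteq> 0 \<and>
    (\<forall>v\<in>V. \<forall>s\<in>S. a v s \<in> E) \<and>
    (\<forall>s\<in>S. \<forall>t\<in>S. a t s = (if t = s then D else 0)) \<and>
    (\<forall>i<r. \<forall>s\<in>S. (\<Sum>v\<in>V. c i v * a v s) = 0)"
    by (elim exE)
  then have IH: "S \<subseteq> V" "card V \<le> card S + r" "D \<in> E" "D \<noteq> 0"
    "\<And>v s. v \<in> V \<Longrightarrow> s \<in> S \<Longrightarrow> a v s \<in> E"
    "\<And>s t. s \<in> S \<Longrightarrow> t \<in> S \<Longrightarrow> a t s = (if t = s then D else 0)"
    "\<And>i s. i < r \<Longrightarrow> s \<in> S \<Longrightarrow> (\<Sum>v\<in>V. c i v * a v s) = 0"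
    by simp_all
  have zero: "0 \<in> E" using diff[OF one one] by simp
  have add: "x + y \<in> E" if "x \<in> E" "y \<in> E" for x y
    using diff[OF that(1) diff[OF zero that(2)]] by simp
  define g where "g s = (\<Sum>v\<in>V. c r v * a v s)" for s
  have sum: "sum f A \<in> E" if "\<And>x. x \<in> A \<Longrightarrow> f x \<in> E" for f and A :: "'v set"
    using that by (induction A rule: infinite_finite_induct) (auto intro: zero add)
  have gE: "g s \<in> E" if "s \<in> S" for s
    unfolding g_def using that Suc.prems IH(5) by (intro sum mult) auto
  show ?case
  proof (cases "\<forall>s\<in>S. g s = 0")
    case True
    then have "\<forall>i<Suc r. \<forall>s\<in>S. (\<Sum>v\<in>V. c i v * a v s) = 0"
      using IH(7) by (auto simp: less_Suc_eq g_def)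
    moreover have "card V \<le> card S + Suc r" using IH(2) by simp
    ultimately show ?thesis
      using IH(1,3-6) by (intro exI[of _ S] exI[of _ a] exI[of _ D]) blast
  next
    case False
    then obtain s0 where s0: "s0 \<in> S" "g s0 \<noteq> 0" by auto
    \<comment> \<open>The new equation has the value \<open>g s\<close> on the solution \<open>s\<close>; the free unknown \<open>s0\<close> is spent to
      cancel this value on all other solutions.\<close>
    define a' where "a' v s = g s0 * a v s - g s * a v s0" for v s
    have eq: "(\<Sum>v\<in>V. c i v * a' v s) = g s0 * (\<Sum>v\<in>V. c i v * a v s) - g s * (\<Sum>v\<in>V. c i v * a v s0)"
      for i s
      by (simp add: a'_def sum_distrib_left right_diff_distrib sum_subtractf mult_ac)
    have "(\<Sum>v\<in>V. c i v * a' v s) = 0" if "i < Suc r" "s \<in> S" for i s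
      using that s0 IH(7) unfolding eq by (cases "i = r") (auto simp: g_def[symmetric])
    moreover have "finite S" using IH(1) V finite_subset by blast
    then have "card V \<le> card (S - {s0}) + Suc r"
      using IH(2) s0(1) by (simp add: card_Diff_singleton)
    moreover have "a' t s = (if t = s then g s0 * D else 0)" if "s \<in> S - {s0}" "t \<in> S - {s0}" for s t
      using that s0 IH(6) by (auto simp: a'_def)
    moreover have "a' v s \<in> E" if "v \<in> V" "s \<in> S - {s0}" for v s
      using that s0 IH(5) gE unfolding a'_def by (intro diff mult) auto
    moreover have "g s0 * D \<in> E" "g s0 * D \<noteq> 0" "S - {s0} \<subseteq> V"
      using IH s0 gE mult by auto
    ultimately show ?thesis
      by (intro exI[of _ "S - {s0}"] exI[of _ a'] exI[of _ "g s0 * D"]) blast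
  qed
qed

section \<open>Polynomials as combinations of monomials\<close>

abbreviation const :: "'a::comm_ring_1 \<Rightarrow> ('v, 'a) mpoly" where
  "const c \<equiv> Poly_Mapping.single 0 c"

lemma mpoly_expand:
  fixes f :: "('v, 'a::comm_ring_1) mpoly"
  shows "f = (\<Sum>m\<in>Poly_Mapping.keys f. Poly_Mapping.single m (Poly_Mapping.lookup f m))"
proof (rule poly_mapping_eqI)
  fix k show "Poly_Mapping.lookup f k = Poly_Mapping.lookup
      (\<Sum>m\<in>Poly_Mapping.keys f. Poly_Mapping.single m (Poly_Mapping.lookup f m)) k"
    by (simp add: lookup_sum lookup_single when_def in_keys_iff)
qed

lemma single_mult_const:
  fixes c :: "'a::comm_ring_1"
  shows "Poly_Mapping.single m c = const c * Poly_Mapping.single m 1"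
  by (simp add: mult_single)

lemma single_sum_one:
  "Poly_Mapping.single (\<Sum>x\<in>A. g x) (1::'a::comm_ring_1) = (\<Prod>x\<in>A. Poly_Mapping.single (g x) 1)"
proof (induction A rule: infinite_finite_induct)
  case (insert x F)
  then show ?case
    using mult_single[of "g x" "1::'a" "sum g F" 1] by simp
qed simp_all

lemma mvar_power:
  "(mvar v :: ('v, 'a::comm_ring_1) mpoly) ^ n = Poly_Mapping.single (Poly_Mapping.single v n) 1"
  by (induction n) (simp_all add: mvar_def mult_single single_add[symmetric])

lemma exponent_expand: "(m :: 'v \<Rightarrow>\<^sub>0 nat) = (\<Sum>v\<in>Poly_Mapping.keys m. Poly_Mapping.single v (Poly_Mapping.lookup m v))"
proof (rule poly_mapping_eqI)
  fix k show "Poly_Mapping.lookup m k = Poly_Mapping.lookup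
      (\<Sum>v\<in>Poly_Mapping.keys m. Poly_Mapping.single v (Poly_Mapping.lookup m v)) k"
    by (simp add: lookup_sum lookup_single when_def in_keys_iff)
qed

lemma monomial_prod:
  "Poly_Mapping.single m 1 = (\<Prod>v\<in>Poly_Mapping.keys m. (mvar v :: ('v, 'a::comm_ring_1) mpoly) ^ Poly_Mapping.lookup m v)"
  by (subst exponent_expand) (simp only: single_sum_one mvar_power)

section \<open>Substitution\<close>

definition subst_mono :: "('v \<Rightarrow> ('w, 'a::comm_ring_1) mpoly) \<Rightarrow> ('v \<Rightarrow>\<^sub>0 nat) \<Rightarrow> ('w, 'a) mpoly" where
  "subst_mono \<rho> m = (\<Prod>v\<in>Poly_Mapping.keys m. \<rho> v ^ Poly_Mapping.lookup m v)"

definition subst :: "('v \<Rightarrow> ('w, 'a::comm_ring_1) mpoly) \<Rightarrow> ('v, 'a) mpoly \<Rightarrow> ('w, 'a) mpoly" where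
  "subst \<rho> f = (\<Sum>m\<in>Poly_Mapping.keys f. const (Poly_Mapping.lookup f m) * subst_mono \<rho> m)"

lemma subst_mono_add: "subst_mono \<rho> (m + m') = subst_mono \<rho> m * subst_mono \<rho> m'"
proof -
  have eq: "subst_mono \<rho> x = (\<Prod>v\<in>A. \<rho> v ^ Poly_Mapping.lookup x v)"
    if "finite A" "Poly_Mapping.keys x \<subseteq> A" for x A
    unfolding subst_mono_def using that
    by (intro prod.mono_neutral_left) (auto simp: in_keys_iff)
  let ?A = "Poly_Mapping.keys m \<union> Poly_Mapping.keys m'"
  have "Poly_Mapping.keys (m + m') \<subseteq> ?A" by (rule keys_add)
  then show ?thesis
    by (subst (1 2 3) eq[of ?A]) (simp_all add: lookup_add power_add prod.distrib)
qed

lemma subst_superset: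
  assumes "finite A" "Poly_Mapping.keys f \<subseteq> A"
  shows "subst \<rho> f = (\<Sum>m\<in>A. const (Poly_Mapping.lookup f m) * subst_mono \<rho> m)"
  unfolding subst_def using assms by (intro sum.mono_neutral_left) (auto simp: in_keys_iff)

lemma subst_single: "subst \<rho> (Poly_Mapping.single m c) = const c * subst_mono \<rho> m"
  by (subst subst_superset[of "{m}"]) auto

lemma subst_add: "subst \<rho> (f + g) = subst \<rho> f + subst \<rho> g"
proof -
  let ?A = "Poly_Mapping.keys f \<union> Poly_Mapping.keys g"
  have "Poly_Mapping.keys (f + g) \<subseteq> ?A" by (rule keys_add)
  then show ?thesis
    by (subst (1 2 3) subst_superset[of ?A])
      (simp_all add: lookup_add single_add distrib_right sum.distrib)
qed

lemma subst_zero [simp]: "subst \<rho> 0 = 0"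
  by (simp add: subst_def)

lemma subst_sum: "subst \<rho> (sum F A) = (\<Sum>x\<in>A. subst \<rho> (F x))"
  by (induction A rule: infinite_finite_induct) (simp_all add: subst_add)

lemma const_mult: "const (a * b) = const a * const b"
  by (simp add: mult_single)

lemma subst_mult: "subst \<rho> (f * g) = subst \<rho> f * subst \<rho> g"
proof -
  have single: "subst \<rho> (Poly_Mapping.single m a * Poly_Mapping.single m' b) =
      (const a * subst_mono \<rho> m) * (const b * subst_mono \<rho> m')" for m m' a b
    unfolding mult_single[of m] subst_single subst_mono_add const_mult by (simp only: mult_ac)
  have "subst \<rho> (f * g) = subst \<rho> ((\<Sum>m\<in>Poly_Mapping.keys f. Poly_Mapping.single m (Poly_Mapping.lookup f m)) *
      (\<Sum>m\<in>Poly_Mapping.keys g. Poly_Mapping.single m (Poly_Mapping.lookup g m)))"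
    using mpoly_expand[of f] mpoly_expand[of g] by simp
  also have "\<dots> = subst \<rho> f * subst \<rho> g"
    by (simp only: sum_product subst_sum single subst_def[of \<rho> f] subst_def[of \<rho> g])
  finally show ?thesis .
qed

lemma subst_const [simp]: "subst \<rho> (const c) = const c"
  by (simp add: subst_single subst_mono_def)

lemma subst_one [simp]: "subst \<rho> 1 = 1"
  using subst_const[of \<rho> 1] by simp

lemma subst_mvar [simp]: "subst \<rho> (mvar v) = \<rho> v"
  by (simp add: mvar_def subst_single subst_mono_def)

lemma subst_power: "subst \<rho> (f ^ n) = subst \<rho> f ^ n"
  by (induction n) (simp_all add: subst_mult)

lemma subst_prod: "subst \<rho> (prod F A) = (\<Prod>x\<in>A. subst \<rho> (F x))"
  by (induction A rule: infinite_finite_induct) (simp_all add: subst_mult)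

lemma subst_subst: "subst \<sigma> (subst \<rho> f) = subst (\<lambda>v. subst \<sigma> (\<rho> v)) f"
  by (simp add: subst_def[of \<rho>] subst_def[of "\<lambda>v. subst \<sigma> (\<rho> v)"] subst_sum subst_mult
      subst_mono_def subst_prod subst_power)

lemma subst_cong:
  assumes "f \<in> carrier (mpoly_ring V)" "\<And>v. v \<in> V \<Longrightarrow> \<rho> v = \<sigma> v"
  shows "subst \<rho> f = subst \<sigma> f"
  using assms unfolding subst_def subst_mono_def mpoly_ring_def
  by (intro sum.cong arg_cong2[where f = "(*)"] prod.cong arg_cong2[where f = "(^)"]) auto

lemma subst_mvar_id: "subst mvar f = f"
  unfolding subst_def subst_mono_def monomial_prod[symmetric] single_mult_const[symmetric]
  by (rule mpoly_expand[symmetric])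

section \<open>Krull dimension of quotients\<close>

text \<open>
  An ideal of \<open>R Quot I\<close> is a set of cosets, so its preimage in \<open>R\<close> is its union.
\<close>

lemma (in cring) primeideal_Union_of_quotient:
  assumes I: "ideal I R" and Q: "primeideal Q (R Quot I)"
  shows "primeideal (\<Union>Q) R" and "I \<subseteq> \<Union>Q" and "(+>) I ` (\<Union>Q) = Q"
proof -
  have Qi: "ideal Q (R Quot I)" using Q by (simp add: primeideal_def)
  have Qs: "Q \<subseteq> carrier (R Quot I)"
    using additive_subgroup.a_subset[OF ideal.axioms(1)[OF Qi]] .
  have eq: "\<Union>Q = {r \<in> carrier R. I +> r \<in> Q}"
    using canonical_proj_vimage_in_carrier[OF I Qs] canonical_proj_vimage_mem_iff[OF I Qs] by blast
  show "primeideal (\<Union>Q) R"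
    unfolding eq
    using ring_hom_ring.primeideal_vimage[OF ideal.rcos_ring_hom_ring[OF I] is_cring Q] .
  have "I \<in> Q"
    using additive_subgroup.zero_closed[OF ideal.axioms(1)[OF Qi]] by (simp add: FactRing_def)
  then show "I \<subseteq> \<Union>Q" by blast
  show "(+>) I ` (\<Union>Q) = Q"
  proof
    show "(+>) I ` (\<Union>Q) \<subseteq> Q" unfolding eq by auto
    show "Q \<subseteq> (+>) I ` (\<Union>Q)"
    proof
      fix x assume x: "x \<in> Q"
      then obtain r where "r \<in> carrier R" "x = I +> r"
        using Qs unfolding FactRing_def A_RCOSETS_def'[of R I] by auto
      then show "x \<in> (+>) I ` (\<Union>Q)" using x unfolding eq by auto
    qed
  qed
qed

lemma (in cring) primeideal_image_in_quotient:
  assumes P: "primeideal P R" and I: "ideal I R" and sub: "I \<subseteq> P"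
  shows "primeideal ((+>) I ` P) (R Quot I)" and "\<Union>((+>) I ` P) = P"
proof -
  have Pi: "ideal P R" using P by (simp add: primeideal_def)
  show U: "\<Union>((+>) I ` P) = P" using ideal_incl_iff[OF I Pi] sub by auto
  have im: "ideal ((+>) I ` P) (R Quot I)" by (rule ring_ideal_imp_quot_ideal[OF I Pi])
  have ims: "(+>) I ` P \<subseteq> carrier (R Quot I)"
    using additive_subgroup.a_subset[OF ideal.axioms(1)[OF im]] .
  have mem: "I +> r \<in> (+>) I ` P \<longleftrightarrow> r \<in> P" if "r \<in> carrier R" for r
    using canonical_proj_vimage_mem_iff[OF I ims that] U by simp
  show "primeideal ((+>) I ` P) (R Quot I)"
  proof (rule primeidealI[OF im])
    show "cring (R Quot I)" using ideal.quotient_is_cring[OF I is_cring] .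
    show "carrier (R Quot I) \<noteq> (+>) I ` P"
    proof
      assume eq: "carrier (R Quot I) = (+>) I ` P"
      have "I +> r \<in> carrier (R Quot I)" if "r \<in> carrier R" for r
        using that unfolding FactRing_def A_RCOSETS_def'[of R I] by auto
      then have "carrier R \<subseteq> P" using mem eq by auto
      then show False
        using primeideal.I_notcarr[OF P] additive_subgroup.a_subset[OF ideal.axioms(1)[OF Pi]] by blast
    qed
    fix a b assume "a \<in> carrier (R Quot I)" "b \<in> carrier (R Quot I)"
      and ab: "a \<otimes>\<^bsub>R Quot I\<^esub> b \<in> (+>) I ` P"
    then obtain r s where rs: "r \<in> carrier R" "s \<in> carrier R" "a = I +> r" "b = I +> s"
      unfolding FactRing_def A_RCOSETS_def'[of R I] by auto
    have "a \<otimes>\<^bsub>R Quot I\<^esub> b = I +> (r \<otimes> s)"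
      using ideal.rcoset_mult_add[OF I rs(1,2)] rs by (simp add: FactRing_def)
    then have "r \<otimes> s \<in> P" using ab rs mem by simp
    then show "a \<in> (+>) I ` P \<or> b \<in> (+>) I ` P"
      using primeideal.I_prime[OF P] rs by blast
  qed
qed

text \<open>
  Chains in the ring itself that lie above \<open>I\<close> stand for the chains of primes of the quotient, so that
  dimensions of quotients can be computed without cosets.
\<close>

definition prime_chain_above :: "('b, 'c) ring_scheme \<Rightarrow> 'b set \<Rightarrow> nat \<Rightarrow> (nat \<Rightarrow> 'b set) \<Rightarrow> bool" where
  "prime_chain_above R I m P \<longleftrightarrow>
     (\<forall>i\<le>m. primeideal (P i) R \<and> I \<subseteq> P i) \<and> (\<forall>i<m. P i \<subset> P (Suc i))"

lemma (in cring) krull_dim_Quot: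
  assumes I: "ideal I R"
  shows "krull_dim (R Quot I) = Sup {ereal (real m) | m. \<exists>P. prime_chain_above R I m P}"
proof -
  have "(\<exists>P. (\<forall>i\<le>m. primeideal (P i) (R Quot I)) \<and> (\<forall>i<m. P i \<subset> P (Suc i))) \<longleftrightarrow>
      (\<exists>P. prime_chain_above R I m P)" (is "?L \<longleftrightarrow> ?R") for m
  proof
    assume ?L
    then obtain P where P: "\<And>i. i \<le> m \<Longrightarrow> primeideal (P i) (R Quot I)" "\<And>i. i < m \<Longrightarrow> P i \<subset> P (Suc i)"
      by blast
    have "\<Union>(P i) \<subset> \<Union>(P (Suc i))" if "i < m" for i
    proof -
      have "P i \<subset> P (Suc i)" "(+>) I ` \<Union>(P i) = P i" "(+>) I ` \<Union>(P (Suc i)) = P (Suc i)"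
        using that P primeideal_Union_of_quotient(3)[OF I] by auto
      then show ?thesis by (metis Union_mono psubset_eq)
    qed
    then show ?R
      using P(1) primeideal_Union_of_quotient(1,2)[OF I]
      by (intro exI[of _ "\<lambda>i. \<Union>(P i)"]) (auto simp: prime_chain_above_def)
  next
    assume ?R
    then obtain P where P: "\<And>i. i \<le> m \<Longrightarrow> primeideal (P i) R" "\<And>i. i \<le> m \<Longrightarrow> I \<subseteq> P i"
      "\<And>i. i < m \<Longrightarrow> P i \<subset> P (Suc i)"
      unfolding prime_chain_above_def by blast
    have "(+>) I ` P i \<subset> (+>) I ` P (Suc i)" if "i < m" for i
    proof -
      have "P i \<subset> P (Suc i)" "\<Union>((+>) I ` P i) = P i" "\<Union>((+>) I ` P (Suc i)) = P (Suc i)"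
        using that P primeideal_image_in_quotient(2)[OF _ I] by auto
      then show ?thesis by (metis image_mono psubset_eq)
    qed
    then show ?L
      using P(1,2) primeideal_image_in_quotient(1)[OF _ I]
      by (intro exI[of _ "\<lambda>i. (+>) I ` P i"]) auto
  qed
  then show ?thesis unfolding krull_dim_def by simp
qed

section \<open>Ideals of polynomial rings\<close>

lemma mpoly_ring_simps [simp]:
  "mult (mpoly_ring V) = (*)" "add (mpoly_ring V) = (+)" "one (mpoly_ring V) = 1" "zero (mpoly_ring V) = 0"
  by (simp_all add: mpoly_ring_def)

abbreviation polys :: "'v set \<Rightarrow> ('v, 'a::comm_ring_1) mpoly set" where
  "polys V \<equiv> carrier (mpoly_ring V)"

lemma polys_iff: "f \<in> polys V \<longleftrightarrow> (\<forall>m\<in>Poly_Mapping.keys f. Poly_Mapping.keys m \<subseteq> V)"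
  by (simp add: mpoly_ring_def)

lemma polys_0 [simp]: "0 \<in> polys V" and polys_1 [simp]: "1 \<in> polys V"
  and polys_const [simp]: "const c \<in> polys V"
  by (simp_all add: polys_iff)

lemma polys_add [intro]: "f \<in> polys V \<Longrightarrow> g \<in> polys V \<Longrightarrow> f + g \<in> polys V"
  using cring.cring_simprules(1)[OF cring_mpoly_ring, of f V g] by simp

lemma polys_mult [intro]: "f \<in> polys V \<Longrightarrow> g \<in> polys V \<Longrightarrow> f * g \<in> polys V"
  using cring.cring_simprules(5)[OF cring_mpoly_ring, of f V g] by simp

lemma polys_minus [intro]: "f \<in> polys V \<Longrightarrow> - f \<in> polys V"
  by (simp add: polys_iff in_keys_iff)

lemma polys_diff [intro]: "f \<in> polys V \<Longrightarrow> g \<in> polys V \<Longrightarrow> f - g \<in> polys V"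
  using polys_add[of f V "- g"] polys_minus[of g V] by simp

lemma polys_power [intro]: "f \<in> polys V \<Longrightarrow> f ^ n \<in> polys V"
  by (induction n) auto

lemma polys_sum [intro]: "(\<And>x. x \<in> A \<Longrightarrow> F x \<in> polys V) \<Longrightarrow> sum F A \<in> polys V"
  by (induction A rule: infinite_finite_induct) auto

lemma polys_mvar [simp]: "v \<in> V \<Longrightarrow> mvar v \<in> polys V"
  by (auto simp: polys_iff mvar_def)

lemma ideal_mpolyI:
  fixes I :: "('v, 'a::comm_ring_1) mpoly set"
  assumes "I \<subseteq> polys V" "0 \<in> I" "\<And>f g. f \<in> I \<Longrightarrow> g \<in> I \<Longrightarrow> f + g \<in> I"
    "\<And>f h. f \<in> I \<Longrightarrow> h \<in> polys V \<Longrightarrow> h * f \<in> I"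
  shows "ideal I (mpoly_ring V)"
proof -
  interpret cring "mpoly_ring V :: ('v, 'a) mpoly ring" by (rule cring_mpoly_ring)
  have neg: "- f \<in> I" if "f \<in> I" for f
    using assms(4)[OF that, of "- 1"] by (simp add: polys_minus)
  have inv: "\<ominus>\<^bsub>mpoly_ring V\<^esub> f = - f" if "f \<in> polys V" for f :: "('v, 'a) mpoly"
    using minus_equality[of "- f" f] that by (simp add: polys_minus)
  show ?thesis
  proof (rule idealI[OF ring_axioms])
    show "subgroup I (add_monoid (mpoly_ring V))"
    proof (rule subgroup.intro)
      show "inv\<^bsub>add_monoid (mpoly_ring V)\<^esub> x \<in> I" if "x \<in> I" for x
        using neg inv that assms(1) unfolding a_inv_def[symmetric] by auto
    qed (use assms in auto)
  qed (use assms in \<open>auto simp: mult.commute\<close>)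
qed

lemma ideal_mpolyD:
  fixes I :: "('v, 'a::comm_ring_1) mpoly set"
  assumes "ideal I (mpoly_ring V)"
  shows ideal_mpoly_subset: "f \<in> I \<Longrightarrow> f \<in> polys V" and ideal_mpoly_0: "0 \<in> I"
    and ideal_mpoly_add: "f \<in> I \<Longrightarrow> g \<in> I \<Longrightarrow> f + g \<in> I"
    and ideal_mpoly_mult: "f \<in> I \<Longrightarrow> h \<in> polys V \<Longrightarrow> h * f \<in> I"
    and ideal_mpoly_mult': "f \<in> I \<Longrightarrow> h \<in> polys V \<Longrightarrow> f * h \<in> I"
proof -
  interpret ideal I "mpoly_ring V" by fact
  show "f \<in> I \<Longrightarrow> f \<in> polys V" by (rule a_Hcarr)
  show "0 \<in> I" using additive_subgroup.zero_closed[OF ideal.axioms(1)[OF assms]] by simp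
  show "f \<in> I \<Longrightarrow> g \<in> I \<Longrightarrow> f + g \<in> I"
    using additive_subgroup.a_closed[OF ideal.axioms(1)[OF assms]] by simp
  show "f \<in> I \<Longrightarrow> h \<in> polys V \<Longrightarrow> h * f \<in> I" using I_l_closed by simp
  show "f \<in> I \<Longrightarrow> h \<in> polys V \<Longrightarrow> f * h \<in> I" using I_r_closed by simp
qed

lemma ideal_mpoly_minus:
  fixes f :: "('v, 'a::comm_ring_1) mpoly"
  shows "ideal I (mpoly_ring V) \<Longrightarrow> f \<in> I \<Longrightarrow> - f \<in> I"
  using ideal_mpoly_mult[of I V f "- 1"] by (simp add: polys_minus)

lemma ideal_mpoly_diff:
  fixes f :: "('v, 'a::comm_ring_1) mpoly"
  shows "ideal I (mpoly_ring V) \<Longrightarrow> f \<in> I \<Longrightarrow> g \<in> I \<Longrightarrow> f - g \<in> I"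
  using ideal_mpoly_add[of I V f "- g"] ideal_mpoly_minus[of I V g] by simp

lemma ideal_mpoly_sum:
  fixes F :: "'b \<Rightarrow> ('v, 'a::comm_ring_1) mpoly"
  shows "ideal I (mpoly_ring V) \<Longrightarrow> (\<And>x. x \<in> A \<Longrightarrow> F x \<in> I) \<Longrightarrow> sum F A \<in> I"
  by (induction A rule: infinite_finite_induct) (auto intro: ideal_mpoly_0 ideal_mpoly_add)

lemma primeideal_mpoly_1:
  fixes P :: "('v, 'a::comm_ring_1) mpoly set"
  assumes "primeideal P (mpoly_ring V)"
  shows "1 \<notin> P"
proof
  assume 1: "1 \<in> P"
  have "ideal P (mpoly_ring V)" using assms by (simp add: primeideal_def)
  then have "P = polys V"
    using 1 ideal_mpoly_mult[OF _ 1] ideal_mpoly_subset by (metis mult.right_neutral subsetI subset_antisym)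
  then show False using primeideal.I_notcarr[OF assms] by simp
qed

lemma primeideal_mpoly_prime:
  fixes P :: "('v, 'a::comm_ring_1) mpoly set"
  assumes "primeideal P (mpoly_ring V)" "f \<in> polys V" "g \<in> polys V" "f * g \<in> P"
  shows "f \<in> P \<or> g \<in> P"
  using primeideal.I_prime[OF assms(1-3)] assms(4) by simp

lemma primeideal_mpoly_power:
  fixes P :: "('v, 'a::comm_ring_1) mpoly set"
  assumes "primeideal P (mpoly_ring V)" "f \<in> polys V" "f ^ n \<in> P"
  shows "f \<in> P"
  using assms(3)
proof (induction n)
  case 0 then show ?case using primeideal_mpoly_1[OF assms(1)] by simp
next
  case (Suc n)
  then show ?case using primeideal_mpoly_prime[OF assms(1,2), of "f ^ n"] assms(2) by auto
qed

lemma ideal_genideal_mpoly: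
  "S \<subseteq> polys V \<Longrightarrow> ideal (Idl\<^bsub>mpoly_ring V\<^esub> S) (mpoly_ring V :: ('v, 'a::comm_ring_1) mpoly ring)"
  using ring.genideal_ideal[OF cring.axioms(1)[OF cring_mpoly_ring]] .

lemma genideal_mpoly_self:
  "S \<subseteq> polys V \<Longrightarrow> f \<in> S \<Longrightarrow> f \<in> Idl\<^bsub>mpoly_ring V\<^esub> (S :: ('v, 'a::comm_ring_1) mpoly set)"
  using ring.genideal_self[OF cring.axioms(1)[OF cring_mpoly_ring]] by blast

lemma genideal_mpoly_minimal:
  "ideal I (mpoly_ring V) \<Longrightarrow> S \<subseteq> I \<Longrightarrow> Idl\<^bsub>mpoly_ring V\<^esub> (S :: ('v, 'a::comm_ring_1) mpoly set) \<subseteq> I"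
  using ring.genideal_minimal[OF cring.axioms(1)[OF cring_mpoly_ring]] .

lemma genideal_finite_combination:
  fixes S :: "('v, 'a::comm_ring_1) mpoly set"
  assumes fin: "finite S" and S: "S \<subseteq> polys V" and f: "f \<in> Idl\<^bsub>mpoly_ring V\<^esub> S"
  obtains g where "\<And>s. s \<in> S \<Longrightarrow> g s \<in> polys V" "f = (\<Sum>s\<in>S. g s * s)"
proof -
  let ?L = "{f. \<exists>g. (\<forall>s\<in>S. g s \<in> polys V) \<and> f = (\<Sum>s\<in>S. g s * s)}"
  have "ideal ?L (mpoly_ring V)"
  proof (rule ideal_mpolyI)
    show "?L \<subseteq> polys V" using S by blast
    show "0 \<in> ?L" by (auto intro!: exI[of _ "\<lambda>_. 0"])
  next
    fix f f' assume "f \<in> ?L" "f' \<in> ?L"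
    then obtain g g' where "\<forall>s\<in>S. g s \<in> polys V" "f = (\<Sum>s\<in>S. g s * s)"
      "\<forall>s\<in>S. g' s \<in> polys V" "f' = (\<Sum>s\<in>S. g' s * s)" by blast
    then show "f + f' \<in> ?L"
      by (auto intro!: exI[of _ "\<lambda>s. g s + g' s"] simp: sum.distrib distrib_right)
  next
    fix f h :: "('v, 'a) mpoly" assume "f \<in> ?L" and h: "h \<in> polys V"
    then obtain g where "\<forall>s\<in>S. g s \<in> polys V" "f = (\<Sum>s\<in>S. g s * s)" by blast
    then show "h * f \<in> ?L"
      using h by (auto intro!: exI[of _ "\<lambda>s. h * g s"] simp: sum_distrib_left mult.assoc)
  qed
  moreover have "S \<subseteq> ?L"
  proof
    fix s assume "s \<in> S"
    then show "s \<in> ?L"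
      using fin by (auto intro!: exI[of _ "\<lambda>t. if t = s then 1 else 0"] simp: if_distrib[of "\<lambda>x. x * _"] cong: if_cong)
  qed
  ultimately have "f \<in> ?L" using genideal_mpoly_minimal f by blast
  then show thesis using that by blast
qed

section \<open>Degrees and homogeneous parts\<close>

lemma mdeg_superset: "finite A \<Longrightarrow> Poly_Mapping.keys m \<subseteq> A \<Longrightarrow> mdeg m = (\<Sum>v\<in>A. Poly_Mapping.lookup m v)"
  unfolding mdeg_def by (intro sum.mono_neutral_left) (auto simp: in_keys_iff)

lemma mdeg_add: "mdeg (m + m') = mdeg m + mdeg m'"
proof -
  let ?A = "Poly_Mapping.keys m \<union> Poly_Mapping.keys m'"
  have "Poly_Mapping.keys (m + m') \<subseteq> ?A" by (rule keys_add)
  then show ?thesis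
    by (subst (1 2 3) mdeg_superset[of ?A]) (simp_all add: lookup_add sum.distrib)
qed

lemma mdeg_0 [simp]: "mdeg 0 = 0"
  by (simp add: mdeg_def)

definition deg_le :: "nat \<Rightarrow> ('v, 'a::comm_ring_1) mpoly \<Rightarrow> bool" where
  "deg_le t f \<longleftrightarrow> (\<forall>m\<in>Poly_Mapping.keys f. mdeg m \<le> t)"

lemma deg_le_mult:
  assumes "deg_le s f" "deg_le t g" shows "deg_le (s + t) (f * g)"
  unfolding deg_le_def
proof
  fix m assume "m \<in> Poly_Mapping.keys (f * g)"
  then obtain a b where "m = a + b" "a \<in> Poly_Mapping.keys f" "b \<in> Poly_Mapping.keys g"
    using keys_mult[of f g] by blast
  then show "mdeg m \<le> s + t"
    using assms by (auto simp: deg_le_def mdeg_add intro: add_mono)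
qed

lemma deg_le_mono: "deg_le s f \<Longrightarrow> s \<le> t \<Longrightarrow> deg_le t f"
  by (auto simp: deg_le_def intro: order_trans)

lemma deg_le_1 [simp]: "deg_le t 1"
  by (simp add: deg_le_def)

lemma deg_le_power: "deg_le e f \<Longrightarrow> deg_le (n * e) (f ^ n)"
  by (induction n) (simp_all add: deg_le_mult)

lemma homogeneous_mult:
  assumes "homogeneous a f" "homogeneous b g" shows "homogeneous (a + b) (f * g)"
  unfolding homogeneous_def
proof
  fix m assume "m \<in> Poly_Mapping.keys (f * g)"
  then obtain i j where "m = i + j" "i \<in> Poly_Mapping.keys f" "j \<in> Poly_Mapping.keys g"
    using keys_mult[of f g] by blast
  then show "mdeg m = a + b"
    using assms by (auto simp: homogeneous_def mdeg_add)
qed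

definition hpart :: "nat \<Rightarrow> ('v, 'a::comm_ring_1) mpoly \<Rightarrow> ('v, 'a) mpoly" where
  "hpart t f = (\<Sum>m | m \<in> Poly_Mapping.keys f \<and> mdeg m = t. Poly_Mapping.single m (Poly_Mapping.lookup f m))"

lemma lookup_hpart: "Poly_Mapping.lookup (hpart t f) m = (if mdeg m = t then Poly_Mapping.lookup f m else 0)"
  by (simp add: hpart_def lookup_sum lookup_single when_def in_keys_iff)

lemma hpart_add: "hpart t (f + g) = hpart t f + hpart t g"
  by (rule poly_mapping_eqI) (simp add: lookup_hpart lookup_add)

lemma hpart_0 [simp]: "hpart t 0 = 0"
  by (rule poly_mapping_eqI) (simp add: lookup_hpart)

lemma hpart_sum: "hpart t (sum F A) = (\<Sum>x\<in>A. hpart t (F x))"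
  by (induction A rule: infinite_finite_induct) (simp_all add: hpart_add)

lemma keys_hpart: "Poly_Mapping.keys (hpart t f) \<subseteq> {m \<in> Poly_Mapping.keys f. mdeg m = t}"
  by (auto simp: in_keys_iff lookup_hpart split: if_splits)

lemma hpart_polys: "f \<in> polys V \<Longrightarrow> hpart t f \<in> polys V"
  using keys_hpart[of t f] by (auto simp: polys_iff)

lemma homogeneous_hpart: "homogeneous t (hpart t f)"
  using keys_hpart[of t f] by (auto simp: homogeneous_def)

lemma hpart_homogeneous: "homogeneous s f \<Longrightarrow> hpart t f = (if s = t then f else 0)"
  by (rule poly_mapping_eqI) (auto simp: lookup_hpart homogeneous_def in_keys_iff)

lemma hpart_decomposition: "f = (\<Sum>a\<in>mdeg ` Poly_Mapping.keys f. hpart a f)"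
  by (rule poly_mapping_eqI) (auto simp: lookup_sum lookup_hpart in_keys_iff)

lemma hpart_mult_homogeneous:
  assumes h: "homogeneous e h"
  shows "hpart t (g * h) = (if e \<le> t then hpart (t - e) g * h else 0)"
proof -
  let ?A = "mdeg ` Poly_Mapping.keys g"
  have fin: "finite ?A" by simp
  have "g * h = (\<Sum>a\<in>?A. hpart a g * h)"
    using hpart_decomposition[of g] by (metis sum_distrib_right)
  then have "hpart t (g * h) = (\<Sum>a\<in>?A. hpart t (hpart a g * h))"
    by (simp only: hpart_sum)
  also have "\<dots> = (\<Sum>a\<in>?A. if a + e = t then hpart a g * h else 0)"
    by (intro sum.cong refl hpart_homogeneous homogeneous_mult homogeneous_hpart h)
  also have "\<dots> = (if e \<le> t then hpart (t - e) g * h else 0)"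
  proof (cases "e \<le> t")
    case True
    then have "(\<Sum>a\<in>?A. if a + e = t then hpart a g * h else 0) =
        (\<Sum>a\<in>?A. if a = t - e then hpart a g * h else 0)"
      by (intro sum.cong refl if_cong) auto
    also have "\<dots> = (if t - e \<in> ?A then hpart (t - e) g * h else 0)"
      by (rule sum.delta[OF fin])
    also have "\<dots> = hpart (t - e) g * h"
    proof (cases "t - e \<in> ?A")
      case notin: False
      have "c \<notin> Poly_Mapping.keys (hpart (t - e) g)" for c
        using notin keys_hpart[of "t - e" g] by (metis (mono_tags, lifting) imageI mem_Collect_eq subsetD)
      then have "hpart (t - e) g = 0" by (metis equals0I keys_eq_empty)
      then show ?thesis by simp
    qed simp
    finally show ?thesis using True by simp
  next
    case False
    then have "a + e \<noteq> t" for a by auto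
    then show ?thesis using False by simp
  qed
  finally show ?thesis .
qed

text \<open>
  Taking the homogeneous part of degree \<open>t\<close> in a representation of \<open>f\<close> by the generators replaces each
  coefficient by one of its homogeneous parts. The coefficients of the generators in \<open>T\<close> then have
  degree less than \<open>t\<close>, because these generators have positive degree; this makes an induction on the
  degree possible.
\<close>

lemma homogeneous_member_of_sum_ideal:
  fixes S T :: "('v, 'a::comm_ring_1) mpoly set"
  assumes S: "finite S" "S \<subseteq> polys V" "\<And>s. s \<in> S \<Longrightarrow> \<exists>d. homogeneous d s"
    and T: "finite T" "T \<subseteq> polys V" "\<And>s. s \<in> T \<Longrightarrow> \<exists>d>0. homogeneous d s"
    and f: "f \<in> Idl\<^bsub>mpoly_ring V\<^esub> (S \<union> T)" "homogeneous t f"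
  obtains i g where "i \<in> Idl\<^bsub>mpoly_ring V\<^esub> S" "\<And>s. s \<in> T \<Longrightarrow> g s \<in> polys V"
    "\<And>s m. s \<in> T \<Longrightarrow> m \<in> Poly_Mapping.keys (g s) \<Longrightarrow> mdeg m < t" "f = i + (\<Sum>s\<in>T. g s * s)"
proof -
  have "\<forall>s\<in>S \<union> T. \<exists>d. homogeneous d s \<and> (s \<in> T \<longrightarrow> d > 0)"
    using S(3) T(3) by blast
  then obtain d where d: "\<And>s. s \<in> S \<union> T \<Longrightarrow> homogeneous (d s) s" "\<And>s. s \<in> T \<Longrightarrow> d s > 0"
    by (metis UnCI)
  have "finite (S \<union> T)" "S \<union> T \<subseteq> polys V" using S T by auto
  from genideal_finite_combination[OF this f(1)] obtain h where
    h: "\<And>s. s \<in> S \<union> T \<Longrightarrow> h s \<in> polys V" "f = (\<Sum>s\<in>S \<union> T. h s * s)" by blast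
  define g where "g s = (if d s \<le> t then hpart (t - d s) (h s) else 0)" for s
  have gp: "g s \<in> polys V" if "s \<in> S \<union> T" for s
    using h(1)[OF that] by (auto simp: g_def hpart_polys)
  have "f = hpart t f" using hpart_homogeneous[OF f(2), of t] by simp
  also have "\<dots> = (\<Sum>s\<in>S \<union> T. g s * s)"
    unfolding h(2) hpart_sum by (rule sum.cong) (simp_all add: hpart_mult_homogeneous[OF d(1)] g_def)
  also have "\<dots> = (\<Sum>s\<in>S. g s * s) + (\<Sum>s\<in>T - S. g s * s)"
    using S(1) T(1) by (simp add: sum.union_disjoint[symmetric] Un_Diff_cancel)
  also have "(\<Sum>s\<in>T - S. g s * s) = (\<Sum>s\<in>T. (if s \<in> S then 0 else g s) * s)"
    using T(1) by (intro sum.mono_neutral_cong_left) auto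
  finally have "f = (\<Sum>s\<in>S. g s * s) + (\<Sum>s\<in>T. (if s \<in> S then 0 else g s) * s)" .
  moreover have "(\<Sum>s\<in>S. g s * s) \<in> Idl\<^bsub>mpoly_ring V\<^esub> S"
    using S(2) gp
    by (intro ideal_mpoly_sum[OF ideal_genideal_mpoly] ideal_mpoly_mult[OF ideal_genideal_mpoly]
        genideal_mpoly_self) auto
  moreover have "mdeg m < t" if "s \<in> T" "m \<in> Poly_Mapping.keys (if s \<in> S then 0 else g s)" for s m
    using that d(2)[of s] keys_hpart[of "t - d s" "h s"] by (auto simp: g_def split: if_splits)
  ultimately show thesis
    using that[of "\<Sum>s\<in>S. g s * s" "\<lambda>s. if s \<in> S then 0 else g s"] gp by auto
qed

section \<open>Power products\<close>

definition powers :: "('v, 'a::comm_ring_1) mpoly list \<Rightarrow> nat list \<Rightarrow> ('v, 'a) mpoly" where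
  "powers fs as = prod_list (map2 (^) fs as)"

lemma powers_Nil [simp]: "powers [] as = 1"
  by (simp add: powers_def)

lemma powers_Cons [simp]: "powers (f # fs) (a # as) = f ^ a * powers fs as"
  by (simp add: powers_def)

definition exponents :: "nat \<Rightarrow> nat \<Rightarrow> nat list set" where
  "exponents n N = {as. length as = n \<and> set as \<subseteq> {..N}}"

lemma finite_exponents: "finite (exponents n N)"
  unfolding exponents_def using finite_lists_length_eq[of "{..N}" n] by (simp add: conj_commute)

lemma card_exponents: "card (exponents n N) = (N + 1) ^ n"
  unfolding exponents_def using card_lists_length_eq[of "{..N}" n] by (simp add: conj_commute)

lemma exponents_0: "exponents 0 N = {[]}"
  by (auto simp: exponents_def)

lemma exponents_Suc: "exponents (Suc n) N = (\<lambda>(a, as). a # as) ` ({..N} \<times> exponents n N)"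
  by (force simp: exponents_def length_Suc_conv image_iff)

lemma sum_exponents_Suc: "(\<Sum>as\<in>exponents (Suc n) N. F as) = (\<Sum>a\<le>N. \<Sum>as\<in>exponents n N. F (a # as))"
  unfolding exponents_Suc
  by (subst sum.reindex) (auto simp: inj_on_def sum.cartesian_product case_prod_unfold intro!: sum.cong)

lemma powers_update:
  "length as = length fs \<Longrightarrow> i < length fs \<Longrightarrow> powers fs as * fs ! i = powers fs (as[i := Suc (as ! i)])"
proof (induction fs arbitrary: as i)
  case (Cons f fs)
  then obtain a as' where as: "as = a # as'" "length as' = length fs" by (cases as) auto
  show ?case
  proof (cases i)
    case (Suc j)
    then have "powers fs as' * fs ! j = powers fs (as'[j := Suc (as' ! j)])" using Cons as by simp
    then show ?thesis using Suc as by (simp add: mult.assoc)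
  qed (use as in \<open>simp add: mult_ac\<close>)
qed simp

lemma powers_replicate_0 [simp]: "powers fs (replicate (length fs) 0) = 1"
  by (induction fs) auto

lemma powers_polys: "set fs \<subseteq> polys V \<Longrightarrow> length as = length fs \<Longrightarrow> powers fs as \<in> polys V"
proof (induction fs arbitrary: as)
  case (Cons f fs) then show ?case by (cases as) auto
qed simp

lemma deg_le_powers:
  "(\<And>f. f \<in> set fs \<Longrightarrow> deg_le e f) \<Longrightarrow> as \<in> exponents (length fs) N \<Longrightarrow> deg_le (length fs * N * e) (powers fs as)"
proof (induction fs arbitrary: as)
  case (Cons f fs)
  then obtain a as' where as: "as = a # as'" "as' \<in> exponents (length fs) N" "a \<le> N"
    by (auto simp: exponents_Suc)
  have "deg_le (N * e) (f ^ a)"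
    using deg_le_mono[OF deg_le_power, of e f a "N * e"] Cons.prems(1) as(3) by simp
  from deg_le_mult[OF this Cons.IH[OF _ as(2)]] show ?case
    using Cons.prems(1) as(1) by (simp add: algebra_simps)
qed simp

lemma const_sum: "const (sum F A) = (\<Sum>x\<in>A. const (F x))"
  by (induction A rule: infinite_finite_induct) (simp_all add: single_add)

section \<open>Strict chains of primes and algebraic independence\<close>

text \<open>
  If \<open>f i\<close> is picked in \<open>P (i + 1) - P i\<close> along a strict chain of primes, then the \<open>f i\<close> are
  algebraically independent modulo \<open>P 0\<close>. Indeed, a relation that is ordered by powers of the first
  element can be divided by the lowest power that occurs, since \<open>P 0\<close> is prime and does not contain
  this element. Its lowest coefficient then lies in \<open>P 1\<close> and is a relation between the other elements,
  which is trivial by induction along the chain.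
\<close>

lemma prime_chain_powers_independent:
  fixes fs :: "('v, 'a::field) mpoly list"
  assumes "\<And>i. i \<le> length fs \<Longrightarrow> primeideal (P i) (mpoly_ring V)"
    and "\<And>i. i < length fs \<Longrightarrow> P i \<subseteq> P (Suc i)"
    and "\<And>i. i < length fs \<Longrightarrow> fs ! i \<in> P (Suc i) - P i"
    and "(\<Sum>as\<in>exponents (length fs) N. const (c as) * powers fs as) \<in> P 0"
    and "as \<in> exponents (length fs) N"
  shows "c as = 0"
  using assms
proof (induction fs arbitrary: P c as)
  case Nil
  then have "const (c []) \<in> P 0" and P: "primeideal (P 0) (mpoly_ring V)"
    by (auto simp: exponents_0)
  then have "c [] \<noteq> 0 \<Longrightarrow> const (inverse (c [])) * const (c []) \<in> P 0"
    by (intro ideal_mpoly_mult) (auto simp: primeideal_def)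
  then have "c [] = 0"
    using primeideal_mpoly_1[OF P] by (auto simp: mult_single)
  then show ?case using Nil by (simp add: exponents_0)
next
  case (Cons f fs)
  have P: "primeideal (P i) (mpoly_ring V)" "ideal (P i) (mpoly_ring V)" if "i \<le> Suc (length fs)" for i
    using that Cons.prems(1)[of i] by (auto simp: primeideal_def)
  have f: "f \<in> P 1" "f \<notin> P 0" and sub: "P 0 \<subseteq> P 1" using Cons.prems(2,3)[of 0] by auto
  have fp: "f \<in> polys V" using ideal_mpoly_subset[OF P(2) f(1)] by simp
  define L where "L = exponents (length fs) N"
  define G where "G a = (\<Sum>as\<in>L. const (c (a # as)) * powers fs as)" for a
  have "set fs \<subseteq> polys V"
  proof
    fix g assume "g \<in> set fs"
    then obtain i where "i < length fs" "g = fs ! i" by (auto simp: in_set_conv_nth)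
    then show "g \<in> polys V"
      using Cons.prems(3)[of "Suc i"] ideal_mpoly_subset[OF P(2)[of "Suc (Suc i)"], of g] by auto
  qed
  then have Gp: "G a \<in> polys V" for a
    unfolding G_def L_def by (intro polys_sum polys_mult polys_const powers_polys) (auto simp: exponents_def)
  have "(\<Sum>as\<in>exponents (length (f # fs)) N. const (c as) * powers (f # fs) as) = (\<Sum>a\<le>N. f ^ a * G a)"
    by (simp add: sum_exponents_Suc G_def L_def sum_distrib_left mult_ac)
  with Cons.prems(4) have tot: "(\<Sum>a\<le>N. f ^ a * G a) \<in> P 0" by simp
  have "\<forall>as\<in>L. c (a # as) = 0" if "a \<le> N" for a
    using that
  proof (induction a rule: less_induct)
    case (less a)
    have "G b = 0" if "b < a" for b
      using less.IH[OF that] that less.prems by (simp add: G_def)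
    then have "(\<Sum>b\<le>N. f ^ b * G b) = (\<Sum>b\<in>{a..N}. f ^ b * G b)"
      by (intro sum.mono_neutral_right) auto
    also have "\<dots> = f ^ a * (\<Sum>b\<in>{a..N}. f ^ (b - a) * G b)"
      unfolding sum_distrib_left
      by (intro sum.cong refl) (simp add: mult.assoc[symmetric] power_add[symmetric])
    finally have "f ^ a * (\<Sum>b\<in>{a..N}. f ^ (b - a) * G b) \<in> P 0" using tot by simp
    then have "f ^ a \<in> P 0 \<or> (\<Sum>b\<in>{a..N}. f ^ (b - a) * G b) \<in> P 0"
      using fp Gp by (intro primeideal_mpoly_prime[OF P(1)]) auto
    moreover have "f ^ a \<notin> P 0" using primeideal_mpoly_power[OF P(1) fp] f by auto
    ultimately have "(\<Sum>b\<in>{a..N}. f ^ (b - a) * G b) \<in> P 1" using sub by blast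
    moreover have "(\<Sum>b\<in>{a..N}. f ^ (b - a) * G b) = G a + (\<Sum>b\<in>{Suc a..N}. f ^ (b - a) * G b)"
      using less.prems by (simp add: sum.atLeast_Suc_atMost)
    moreover have "(\<Sum>b\<in>{Suc a..N}. f ^ (b - a) * G b) \<in> P 1"
    proof (rule ideal_mpoly_sum[OF P(2)])
      fix b assume "b \<in> {Suc a..N}"
      then have "f ^ (b - a) = f * f ^ (b - Suc a)"
        by (metis Suc_diff_Suc Suc_le_lessD atLeastAtMost_iff power_Suc)
      then show "f ^ (b - a) * G b \<in> P 1"
        using f fp Gp by (auto intro!: ideal_mpoly_mult'[OF P(2)] polys_mult polys_power)
    qed simp
    ultimately have rest: "G a + (\<Sum>b\<in>{Suc a..N}. f ^ (b - a) * G b) \<in> P 1"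
      "(\<Sum>b\<in>{Suc a..N}. f ^ (b - a) * G b) \<in> P 1" by simp_all
    have Ga: "G a \<in> P 1"
      using ideal_mpoly_diff[OF P(2)[of 1] rest] by simp
    show ?case
    proof
      fix as assume as: "as \<in> L"
      show "c (a # as) = 0"
      proof (rule Cons.IH[of "\<lambda>i. P (Suc i)" "\<lambda>as. c (a # as)"])
        show "as \<in> exponents (length fs) N" using as by (simp add: L_def)
        show "(\<Sum>as\<in>exponents (length fs) N. const (c (a # as)) * powers fs as) \<in> P (Suc 0)"
          using Ga by (simp add: G_def L_def)
        show "fs ! i \<in> P (Suc (Suc i)) - P (Suc i)" if "i < length fs" for i
          using Cons.prems(3)[of "Suc i"] that by simp
      qed (use Cons.prems(1,2) in auto)
    qed
  qed
  then show ?case using Cons.prems(5) by (auto simp: exponents_Suc L_def)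
qed

section \<open>Growth of the quotient and the upper bound for its dimension\<close>

interpretation mpoly_space: vector_space "\<lambda>(c :: 'a::field) (p :: ('v, 'a) mpoly). const c * p"
  by unfold_locales (simp_all only: distrib_left distrib_right single_add const_mult mult.assoc single_one mult_1_left)

lemma finite_monomials_of_bounded_degree:
  assumes "finite V"
  shows "finite {m :: 'v \<Rightarrow>\<^sub>0 nat. Poly_Mapping.keys m \<subseteq> V \<and> mdeg m < D}"
proof (rule finite_imageD)
  let ?M = "{m :: 'v \<Rightarrow>\<^sub>0 nat. Poly_Mapping.keys m \<subseteq> V \<and> mdeg m < D}"
  let ?F = "{f. \<forall>v. (v \<in> V \<longrightarrow> f v \<in> {..<D}) \<and> (v \<notin> V \<longrightarrow> f v = (0::nat))}"
  have "Poly_Mapping.lookup m v < D" if "m \<in> ?M" "v \<in> V" for m v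
  proof -
    have "Poly_Mapping.lookup m v \<le> (\<Sum>v\<in>V. Poly_Mapping.lookup m v)"
      using assms that by (intro member_le_sum) auto
    then show ?thesis using that mdeg_superset[OF assms, of m] by auto
  qed
  then have "Poly_Mapping.lookup ` ?M \<subseteq> ?F" by (auto simp: in_keys_iff)
  moreover have "finite ?F" by (rule finite_set_of_finite_funs) (use assms in auto)
  ultimately show "finite (Poly_Mapping.lookup ` ?M)" by (rule finite_subset)
  show "inj_on Poly_Mapping.lookup ?M" by (rule inj_onI) (simp only: poly_mapping_eq_iff)
qed

text \<open>
  Power products of the parameters \<open>ts\<close> with exponents at most \<open>t\<close>, times the monomials of degree less
  than \<open>D\<close>. For fixed \<open>D\<close> their number grows like \<open>t\<close> to the power of the number of parameters.
\<close>

definition graded_generators :: "'v set \<Rightarrow> nat \<Rightarrow> ('v, 'a::comm_ring_1) mpoly list \<Rightarrow> nat \<Rightarrow> ('v, 'a) mpoly set" where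
  "graded_generators V D ts t =
     (\<lambda>(as, m). powers ts as * Poly_Mapping.single m 1) `
       (exponents (length ts) t \<times> {m. Poly_Mapping.keys m \<subseteq> V \<and> mdeg m < D})"

lemma graded_generators_mono: "s \<le> t \<Longrightarrow> graded_generators V D ts s \<subseteq> graded_generators V D ts t"
  unfolding graded_generators_def exponents_def by (intro image_mono Sigma_mono order_refl) auto

lemma graded_generators_mult:
  assumes "\<tau> \<in> set ts" "b \<in> graded_generators V D ts t"
  shows "b * \<tau> \<in> graded_generators V D ts (Suc t)"
proof -
  obtain as m where b: "b = powers ts as * Poly_Mapping.single m 1" "as \<in> exponents (length ts) t"
    "Poly_Mapping.keys m \<subseteq> V" "mdeg m < D"
    using assms(2) by (auto simp: graded_generators_def)
  obtain i where i: "i < length ts" "ts ! i = \<tau>"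
    using assms(1) by (auto simp: in_set_conv_nth)
  have len: "length as = length ts" "\<forall>x\<in>set as. x \<le> t" using b(2) by (auto simp: exponents_def)
  have "b * \<tau> = (powers ts as * ts ! i) * Poly_Mapping.single m 1"
    using b(1) i by (simp add: mult_ac)
  also have "\<dots> = powers ts (as[i := Suc (as ! i)]) * Poly_Mapping.single m 1"
    using powers_update[of as ts i] len i by simp
  finally have eq: "b * \<tau> = powers ts (as[i := Suc (as ! i)]) * Poly_Mapping.single m 1" .
  have "x \<le> Suc t" if "x \<in> set (as[i := Suc (as ! i)])" for x
  proof -
    have "x = Suc (as ! i) \<or> x \<in> set as" using that set_update_subset_insert[of as i] by auto
    moreover have "as ! i \<in> set as" using len i by simp
    ultimately show ?thesis using len by fastforce
  qed
  then have "as[i := Suc (as ! i)] \<in> exponents (length ts) (Suc t)"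
    using len by (auto simp: exponents_def)
  then show ?thesis
    unfolding eq graded_generators_def using b(3,4)
    by (intro rev_image_eqI[of "(as[i := Suc (as ! i)], m)"]) simp_all
qed

lemma card_graded_generators:
  assumes "finite V"
  shows "finite (graded_generators V D ts t)"
    and "card (graded_generators V D ts t) \<le>
      (t + 1) ^ length ts * card {m. Poly_Mapping.keys m \<subseteq> V \<and> mdeg m < D}"
proof -
  let ?A = "exponents (length ts) t \<times> {m. Poly_Mapping.keys m \<subseteq> V \<and> mdeg m < D}"
  have fin: "finite ?A" using finite_exponents finite_monomials_of_bounded_degree[OF assms] by auto
  then show "finite (graded_generators V D ts t)" unfolding graded_generators_def by auto
  have "card (graded_generators V D ts t) \<le> card ?A"
    unfolding graded_generators_def by (rule card_image_le[OF fin])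
  then show "card (graded_generators V D ts t) \<le>
      (t + 1) ^ length ts * card {m. Poly_Mapping.keys m \<subseteq> V \<and> mdeg m < D}"
    by (simp add: card_cartesian_product card_exponents)
qed

lemma homogeneous_single: "homogeneous (mdeg m) (Poly_Mapping.single m c)"
  by (auto simp: homogeneous_def)

lemma single_polys: "Poly_Mapping.keys m \<subseteq> V \<Longrightarrow> Poly_Mapping.single m c \<in> polys V"
  by (auto simp: polys_iff)

text \<open>
  In a monomial of large degree some variable occurs with a large exponent.
\<close>

lemma monomial_in_ideal_of_large_degree:
  fixes J :: "('v, 'a::comm_ring_1) mpoly set"
  assumes J: "ideal J (mpoly_ring V)" and V: "finite V"
    and nil: "\<And>v. v \<in> V \<Longrightarrow> mvar v ^ e \<in> J"
    and m: "Poly_Mapping.keys m \<subseteq> V" "mdeg m \<ge> card V * e + 1"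
  shows "Poly_Mapping.single m 1 \<in> J"
proof -
  have "\<exists>v\<in>V. Poly_Mapping.lookup m v \<ge> e"
  proof (rule ccontr)
    assume "\<not> ?thesis"
    then have "mdeg m \<le> (\<Sum>v\<in>V. e)"
      unfolding mdeg_superset[OF V m(1)] by (intro sum_mono) auto
    then show False using m(2) by simp
  qed
  then obtain v where v: "v \<in> V" "Poly_Mapping.lookup m v \<ge> e" by blast
  define m' where "m' = m - Poly_Mapping.single v e"
  have "m = m' + Poly_Mapping.single v e"
    by (rule poly_mapping_eqI)
      (use v(2) in \<open>auto simp: m'_def lookup_add lookup_minus lookup_single when_def\<close>)
  then have "Poly_Mapping.single m (1::'a) = Poly_Mapping.single m' 1 * mvar v ^ e"
    by (simp add: mvar_power mult_single)
  moreover have "Poly_Mapping.keys m' \<subseteq> V"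
    using m(1) by (auto simp: m'_def in_keys_iff lookup_minus)
  ultimately show ?thesis
    using ideal_mpoly_mult[OF J nil[OF v(1)] single_polys[of m' V 1]] by simp
qed

text \<open>
  The graded Nakayama lemma with control of the degrees: if all variables are nilpotent modulo the ideal
  of \<open>S\<close> and the parameters \<open>ts\<close>, then the monomials of small degree generate the quotient by \<open>S\<close> over
  the subalgebra of the parameters. A monomial of large degree lies in the ideal of \<open>S\<close> and \<open>ts\<close>, and
  by homogeneity the coefficients of the parameters have smaller degree, so induction applies to them.
\<close>

lemma spanned_by_graded_generators:
  fixes S :: "('v, 'a::field) mpoly set"
  assumes V: "finite V"
    and S: "finite S" "S \<subseteq> polys V" "\<And>s. s \<in> S \<Longrightarrow> \<exists>d. homogeneous d s"
    and T: "set ts \<subseteq> polys V" "\<And>s. s \<in> set ts \<Longrightarrow> \<exists>d>0. homogeneous d s"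
    and nil: "\<And>v. v \<in> V \<Longrightarrow> mvar v ^ e \<in> Idl\<^bsub>mpoly_ring V\<^esub> (S \<union> set ts)"
    and f: "f \<in> polys V" "deg_le t f"
  shows "\<exists>i\<in>Idl\<^bsub>mpoly_ring V\<^esub> S. \<exists>b\<in>mpoly_space.span (graded_generators V (card V * e + 1) ts t). f = i + b"
proof -
  let ?I = "Idl\<^bsub>mpoly_ring V\<^esub> S"
  define D where "D = card V * e + 1"
  define B where "B = graded_generators V D ts"
  define W where "W t = {i + b | i b. i \<in> ?I \<and> b \<in> mpoly_space.span (B t)}" for t
  have I: "ideal ?I (mpoly_ring V)" by (rule ideal_genideal_mpoly[OF S(2)])
  have Wadd: "f + g \<in> W t" if fg: "f \<in> W t" "g \<in> W t" for f g t
  proof -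
    obtain i b j c where "f = i + b" "g = j + c" "i \<in> ?I" "j \<in> ?I"
      "b \<in> mpoly_space.span (B t)" "c \<in> mpoly_space.span (B t)"
      using fg unfolding W_def by blast
    moreover from this have "f + g = (i + j) + (b + c)" by simp
    ultimately show ?thesis
      unfolding W_def using ideal_mpoly_add[OF I] mpoly_space.span_add by blast
  qed
  have Wmono: "W s \<subseteq> W t" if "s \<le> t" for s t
    using mpoly_space.span_mono[OF graded_generators_mono[OF that, of V D ts]]
    unfolding W_def B_def by blast
  have Winc: "i \<in> W t" if "i \<in> ?I" for i t
    unfolding W_def using that mpoly_space.span_zero[of "B t"]
    by (intro CollectI exI[of _ i] exI[of _ 0]) simp
  have Wbase: "b \<in> W t" if "b \<in> B t" for b t
    unfolding W_def using ideal_mpoly_0[OF I] mpoly_space.span_base[OF that]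
    by (intro CollectI exI[of _ 0] exI[of _ b]) simp
  have Wscale: "const c * f \<in> W t" if "f \<in> W t" for c f t
  proof -
    obtain i b where "f = i + b" "i \<in> ?I" "b \<in> mpoly_space.span (B t)"
      using \<open>f \<in> W t\<close> unfolding W_def by blast
    then have "const c * f = const c * i + const c * b" "const c * i \<in> ?I" "const c * b \<in> mpoly_space.span (B t)"
      using ideal_mpoly_mult[OF I] mpoly_space.span_scale by (auto simp: distrib_left)
    then show ?thesis unfolding W_def by blast
  qed
  have Wsum: "sum F A \<in> W t" if "\<And>x. x \<in> A \<Longrightarrow> F x \<in> W t" for A :: "'b set" and F t
    using that by (induction A rule: infinite_finite_induct) (auto intro: Wadd Winc ideal_mpoly_0[OF I])
  have Wmult: "f * \<tau> \<in> W (Suc t)" if fW: "f \<in> W t" and tau: "\<tau> \<in> set ts" for f \<tau> t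
  proof -
    obtain i b where f: "f = i + b" "i \<in> ?I" "b \<in> mpoly_space.span (B t)"
      using fW unfolding W_def by blast
    have "b * \<tau> \<in> mpoly_space.span (B (Suc t))"
      using f(3)
    proof (induction rule: mpoly_space.span_induct_alt)
      case base show ?case using mpoly_space.span_zero by simp
    next
      case (step c x y)
      have "x * \<tau> \<in> mpoly_space.span (B (Suc t))"
        using mpoly_space.span_base graded_generators_mult[OF tau] step(1) unfolding B_def by blast
      then have "const c * (x * \<tau>) + y * \<tau> \<in> mpoly_space.span (B (Suc t))"
        using step mpoly_space.span_add mpoly_space.span_scale by blast
      then show ?case by (simp add: distrib_right mult.assoc)
    qed
    moreover have "i * \<tau> \<in> ?I" using ideal_mpoly_mult'[OF I f(2)] tau T(1) by blast
    ultimately show ?thesis unfolding W_def f(1) distrib_right by blast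
  qed
  have Wpoly: "f \<in> W t"
    if "\<And>m. m \<in> Poly_Mapping.keys f \<Longrightarrow> Poly_Mapping.single m 1 \<in> W t" for f t
  proof -
    have "f = (\<Sum>m\<in>Poly_Mapping.keys f. const (Poly_Mapping.lookup f m) * Poly_Mapping.single m 1)"
      using mpoly_expand[of f] by (simp only: single_mult_const[symmetric])
    also have "\<dots> \<in> W t" by (intro Wsum Wscale that)
    finally show ?thesis .
  qed
  have mono: "Poly_Mapping.single m 1 \<in> W (mdeg m)" if "Poly_Mapping.keys m \<subseteq> V" for m
    using that
  proof (induction "mdeg m" arbitrary: m rule: less_induct)
    case less
    show ?case
    proof (cases "mdeg m < D")
      case True
      then have "powers ts (replicate (length ts) 0) * Poly_Mapping.single m 1 \<in> B (mdeg m)"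
        unfolding B_def graded_generators_def using less.prems
        by (intro rev_image_eqI[of "(replicate (length ts) 0, m)"]) (auto simp: exponents_def)
      then show ?thesis using Wbase by simp
    next
      case False
      then have D: "mdeg m \<ge> card V * e + 1" by (simp add: D_def)
      have J: "ideal (Idl\<^bsub>mpoly_ring V\<^esub> (S \<union> set ts)) (mpoly_ring V)"
        using S(2) T(1) by (intro ideal_genideal_mpoly) auto
      have "Poly_Mapping.single m 1 \<in> Idl\<^bsub>mpoly_ring V\<^esub> (S \<union> set ts)"
        by (rule monomial_in_ideal_of_large_degree[OF J V nil less.prems D])
      from homogeneous_member_of_sum_ideal[OF S finite_set T this homogeneous_single]
      obtain i g where ig: "i \<in> ?I" "\<And>s. s \<in> set ts \<Longrightarrow> g s \<in> polys V"
        "\<And>s m'. s \<in> set ts \<Longrightarrow> m' \<in> Poly_Mapping.keys (g s) \<Longrightarrow> mdeg m' < mdeg m"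
        "Poly_Mapping.single m 1 = i + (\<Sum>s\<in>set ts. g s * s)" by blast
      have "g s * s \<in> W (mdeg m)" if s: "s \<in> set ts" for s
      proof -
        have "g s \<in> W (mdeg m - 1)"
        proof (rule Wpoly)
          fix m' assume m': "m' \<in> Poly_Mapping.keys (g s)"
          then have "mdeg m' < mdeg m" "Poly_Mapping.keys m' \<subseteq> V"
            using ig(2,3)[OF s] by (auto simp: polys_iff)
          moreover from this have "mdeg m' \<le> mdeg m - 1" by simp
          ultimately show "Poly_Mapping.single m' 1 \<in> W (mdeg m - 1)"
            using less.hyps[of m'] Wmono[of "mdeg m'" "mdeg m - 1"] by blast
        qed
        then show ?thesis using Wmult[OF _ s, of "g s" "mdeg m - 1"] D by simp
      qed
      then show ?thesis unfolding ig(4) by (intro Wadd[OF Winc[OF ig(1)]] Wsum)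
    qed
  qed
  have "f \<in> W t"
  proof (rule Wpoly)
    fix m assume "m \<in> Poly_Mapping.keys f"
    then show "Poly_Mapping.single m 1 \<in> W t"
      using f mono[of m] Wmono[of "mdeg m" t] by (auto simp: polys_iff deg_le_def)
  qed
  then show ?thesis unfolding W_def B_def D_def by blast
qed

text \<open>
  Elimination applied to the coefficient vectors of the elements with respect to \<open>B\<close>.
\<close>

lemma linear_relation_mod_ideal:
  fixes p :: "'b \<Rightarrow> ('v, 'a::field) mpoly"
  assumes I: "ideal I (mpoly_ring V)" and A: "finite A" and B: "finite B" "card B < card A"
    and p: "\<And>x. x \<in> A \<Longrightarrow> \<exists>i\<in>I. \<exists>b\<in>mpoly_space.span B. p x = i + b"
  obtains c x where "(\<Sum>x\<in>A. const (c x) * p x) \<in> I" "x \<in> A" "c x \<noteq> 0"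
proof -
  obtain q b where q: "\<And>x. x \<in> A \<Longrightarrow> q x \<in> I" "\<And>x. x \<in> A \<Longrightarrow> b x \<in> mpoly_space.span B"
    "\<And>x. x \<in> A \<Longrightarrow> p x = q x + b x"
    using p by metis
  have "\<forall>x\<in>A. \<exists>u. b x = (\<Sum>v\<in>B. const (u v) * v)"
    using q(2) unfolding mpoly_space.span_finite[OF B(1)] by auto
  from bchoice[OF this] obtain u where u: "\<forall>x\<in>A. b x = (\<Sum>v\<in>B. const (u x v) * v)"
    by (elim exE)
  obtain h where h: "bij_betw h {..<card B} B"
    using ex_bij_betw_nat_finite[OF B(1)] unfolding atLeast0LessThan by (elim exE)
  have "\<exists>S a D. S \<subseteq> A \<and> card A \<le> card S + card B \<and> D \<in> (UNIV :: 'a set) \<and> D \<noteq> 0 \<and>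
      (\<forall>v\<in>A. \<forall>s\<in>S. a v s \<in> UNIV) \<and>
      (\<forall>s\<in>S. \<forall>t\<in>S. a t s = (if t = s then D else 0)) \<and>
      (\<forall>i<card B. \<forall>s\<in>S. (\<Sum>v\<in>A. u v (h i) * a v s) = 0)"
    by (rule homogeneous_linear_system[OF A, where c = "\<lambda>i v. u v (h i)" and E = UNIV and r = "card B"])
      (rule UNIV_I)+
  then obtain S a D where sol0: "S \<subseteq> A \<and> card A \<le> card S + card B \<and> D \<in> (UNIV :: 'a set) \<and> D \<noteq> 0 \<and>
      (\<forall>v\<in>A. \<forall>s\<in>S. a v s \<in> UNIV) \<and>
      (\<forall>s\<in>S. \<forall>t\<in>S. a t s = (if t = s then D else 0)) \<and>
      (\<forall>i<card B. \<forall>s\<in>S. (\<Sum>v\<in>A. u v (h i) * a v s) = 0)"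
    by (elim exE)
  then have sol: "S \<subseteq> A" "card A \<le> card S + card B" "D \<noteq> 0"
    "\<And>s t. s \<in> S \<Longrightarrow> t \<in> S \<Longrightarrow> a t s = (if t = s then D else 0)"
    "\<And>i s. i < card B \<Longrightarrow> s \<in> S \<Longrightarrow> (\<Sum>v\<in>A. u v (h i) * a v s) = 0"
    by simp_all
  have "S \<noteq> {}" using sol(2) B(2) by auto
  then obtain s where s: "s \<in> S" by blast
  have zero: "(\<Sum>x\<in>A. a x s * u x v) = 0" if "v \<in> B" for v
  proof -
    have "v \<in> h ` {..<card B}" using h that by (simp add: bij_betw_def)
    then obtain i where "i < card B" "h i = v" by blast
    then show ?thesis using sol(5)[of i s] s by (simp add: mult.commute)
  qed
  have comb: "const (a x s) * p x = const (a x s) * q x + (\<Sum>v\<in>B. const (a x s * u x v) * v)"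
    if x: "x \<in> A" for x
  proof -
    have "const (a x s) * p x = const (a x s) * q x + const (a x s) * b x"
      by (simp only: q(3)[OF x] distrib_left)
    also have "const (a x s) * b x = (\<Sum>v\<in>B. const (a x s * u x v) * v)"
      by (simp only: bspec[OF u x] sum_distrib_left const_mult mult.assoc)
    finally show ?thesis .
  qed
  have "(\<Sum>x\<in>A. const (a x s) * p x) =
      (\<Sum>x\<in>A. const (a x s) * q x) + (\<Sum>x\<in>A. \<Sum>v\<in>B. const (a x s * u x v) * v)"
    by (simp only: comb sum.distrib cong: sum.cong)
  also have "(\<Sum>x\<in>A. \<Sum>v\<in>B. const (a x s * u x v) * v) =
      (\<Sum>v\<in>B. const (\<Sum>x\<in>A. a x s * u x v) * v)"
    by (subst sum.swap) (simp only: const_sum sum_distrib_right)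
  also have "\<dots> = (\<Sum>v\<in>B. 0)"
    by (rule sum.cong[OF refl]) (simp only: zero single_zero mult_zero_left)
  finally have "(\<Sum>x\<in>A. const (a x s) * p x) = (\<Sum>x\<in>A. const (a x s) * q x)" by simp
  moreover have "(\<Sum>x\<in>A. const (a x s) * q x) \<in> I"
    by (intro ideal_mpoly_sum[OF I] ideal_mpoly_mult[OF I] q(1)) auto
  ultimately show thesis
    using that[of "\<lambda>x. a x s" s] s sol(1,3,4) by auto
qed

text \<open>
  Suppose that there is a chain of primes of length \<open>m\<close>. It yields \<open>m\<close> algebraically independent
  elements of the quotient, whose power products with exponents at most \<open>N\<close> are \<open>(N + 1) ^ m\<close> many
  independent elements of degree \<open>O(N)\<close>. On the other hand, elements of degree \<open>O(N)\<close> are spanned by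
  \<open>O(N ^ card T)\<close> graded generators. For large \<open>N\<close> this forces \<open>m \<le> card T\<close>.
\<close>

theorem krull_dim_le_card_parameters:
  fixes S T :: "('v, 'a::field) mpoly set"
  assumes V: "finite V"
    and S: "finite S" "S \<subseteq> polys V" "\<And>s. s \<in> S \<Longrightarrow> \<exists>d. homogeneous d s"
    and T: "finite T" "T \<subseteq> polys V" "\<And>s. s \<in> T \<Longrightarrow> \<exists>d>0. homogeneous d s"
    and nil: "\<And>v. v \<in> V \<Longrightarrow> \<exists>n. mvar v ^ n \<in> Idl\<^bsub>mpoly_ring V\<^esub> (S \<union> T)"
  shows "krull_dim (mpoly_ring V Quot Idl\<^bsub>mpoly_ring V\<^esub> S) \<le> card T"
proof -
  let ?I = "Idl\<^bsub>mpoly_ring V\<^esub> S" and ?J = "Idl\<^bsub>mpoly_ring V\<^esub> (S \<union> T)"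
  have I: "ideal ?I (mpoly_ring V)" by (rule ideal_genideal_mpoly[OF S(2)])
  have J: "ideal ?J (mpoly_ring V)" using S(2) T(2) by (intro ideal_genideal_mpoly) auto
  obtain ts where ts: "set ts = T" "length ts = card T"
    using finite_distinct_list[OF T(1)] distinct_card by metis
  obtain n where n: "\<And>v. v \<in> V \<Longrightarrow> mvar v ^ n v \<in> ?J" using nil by metis
  define e where "e = Max (insert 0 (n ` V))"
  have e: "mvar v ^ e \<in> ?J" if v: "v \<in> V" for v
  proof -
    have "n v \<le> e" unfolding e_def using V v by (intro Max_ge) auto
    then have "(mvar v :: ('v, 'a) mpoly) ^ e = mvar v ^ (e - n v) * mvar v ^ n v"
      by (simp add: power_add[symmetric])
    then show ?thesis
      using ideal_mpoly_mult[OF J n[OF v]] polys_power[OF polys_mvar[OF v]] by metis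
  qed
  have bound: "m \<le> card T" if chain: "prime_chain_above (mpoly_ring V) ?I m P" for m P
  proof (rule ccontr)
    assume m: "\<not> m \<le> card T"
    have P: "\<And>i. i \<le> m \<Longrightarrow> primeideal (P i) (mpoly_ring V)" "\<And>i. i \<le> m \<Longrightarrow> ?I \<subseteq> P i"
      "\<And>i. i < m \<Longrightarrow> P i \<subset> P (Suc i)"
      using chain unfolding prime_chain_above_def by auto
    have "\<exists>f. f \<in> P (Suc i) - P i" if "i < m" for i using P(3)[OF that] by blast
    then obtain f where f: "\<And>i. i < m \<Longrightarrow> f i \<in> P (Suc i) - P i" by metis
    define fs where "fs = map f [0..<m]"
    have len: "length fs = m" by (simp add: fs_def)
    have fsp: "set fs \<subseteq> polys V"
    proof
      fix g assume "g \<in> set fs"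
      then obtain i where "i < m" "g = f i" by (auto simp: fs_def)
      then have "g \<in> P (Suc i)" "ideal (P (Suc i)) (mpoly_ring V)"
        using f P(1)[of "Suc i"] by (auto simp: primeideal_def)
      then show "g \<in> polys V" using ideal_mpoly_subset by blast
    qed
    define E where "E = Max (insert 0 (mdeg ` (\<Union>g\<in>set fs. Poly_Mapping.keys g)))"
    have E: "deg_le E g" if "g \<in> set fs" for g
      unfolding deg_le_def E_def using that by (intro ballI Max_ge) auto
    define s where "s = card {m. Poly_Mapping.keys m \<subseteq> V \<and> mdeg m < card V * e + 1}"
    \<comment> \<open>The power products have degree at most \<open>m * N * E\<close>, so there are at most
      \<open>((m * E + 1) * (N + 1)) ^ card T * s = N * (N + 1) ^ card T\<close> graded generators, which is less than
      \<open>(N + 1) ^ m\<close>.\<close>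
    define N where "N = (m * E + 1) ^ card T * s"
    define B where "B = (graded_generators V (card V * e + 1) ts (m * N * E) :: ('v, 'a) mpoly set)"
    have finB: "finite B" unfolding B_def by (rule card_graded_generators[OF V])
    have "card B \<le> (m * N * E + 1) ^ card T * s"
      using card_graded_generators(2)[OF V, of "card V * e + 1" ts "m * N * E"]
      unfolding B_def s_def ts(2) .
    also have "\<dots> \<le> ((m * E + 1) * (N + 1)) ^ card T * s"
      by (intro mult_right_mono power_mono) (auto simp: algebra_simps)
    also have "\<dots> = N * (N + 1) ^ card T"
      by (simp only: power_mult_distrib N_def mult_ac)
    also have "\<dots> < (N + 1) ^ Suc (card T)" by simp
    also have "\<dots> \<le> (N + 1) ^ m" using m by (intro power_increasing) auto
    finally have card: "card B < card (exponents m N)" by (simp add: card_exponents)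
    have span: "\<exists>i\<in>?I. \<exists>b\<in>mpoly_space.span B. powers fs as = i + b" if as: "as \<in> exponents m N" for as
      unfolding B_def
    proof (rule spanned_by_graded_generators[OF V S])
      show "set ts \<subseteq> polys V" "\<And>s. s \<in> set ts \<Longrightarrow> \<exists>d>0. homogeneous d s" using T ts by auto
      show "\<And>v. v \<in> V \<Longrightarrow> mvar v ^ e \<in> Idl\<^bsub>mpoly_ring V\<^esub> (S \<union> set ts)" using e ts by simp
      show "powers fs as \<in> polys V" using as len by (intro powers_polys fsp) (auto simp: exponents_def)
      show "deg_le (m * N * E) (powers fs as)"
        using deg_le_powers[OF E, of fs as N] as len by simp
    qed
    obtain c as where c: "(\<Sum>as\<in>exponents m N. const (c as) * powers fs as) \<in> ?I" "as \<in> exponents m N" "c as \<noteq> 0"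
      using linear_relation_mod_ideal[where p = "powers fs", OF I finite_exponents finB card span] by blast
    have "c as = 0"
      by (rule prime_chain_powers_independent[where fs = fs and P = P and N = N])
        (use P f c len in \<open>auto simp: fs_def less_imp_le\<close>)
    then show False using c(3) by simp
  qed
  show ?thesis
    unfolding cring.krull_dim_Quot[OF cring_mpoly_ring I]
    by (rule Sup_least) (use bound in auto)
qed

section \<open>A lower bound for ideals of linear equations\<close>

lemma primeideal_kernel_subst:
  fixes \<rho> :: "'v \<Rightarrow> ('w::linorder, 'a::idom) mpoly"
  shows "primeideal {f \<in> polys V. subst \<rho> f = 0} (mpoly_ring V)"
proof (rule primeidealI[OF _ cring_mpoly_ring])
  show "ideal {f \<in> polys V. subst \<rho> f = 0} (mpoly_ring V)"
    by (rule ideal_mpolyI) (auto simp: subst_add subst_mult)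
  have "1 \<in> polys V" "1 \<notin> {f \<in> polys V. subst \<rho> f = 0}" by simp_all
  then show "carrier (mpoly_ring V) \<noteq> {f \<in> polys V. subst \<rho> f = 0}" by blast
qed (auto simp: subst_mult)

lemma mvar_neq_0 [simp]: "(mvar v :: ('v, 'a::comm_ring_1) mpoly) \<noteq> 0"
proof
  assume "(mvar v :: ('v, 'a) mpoly) = 0"
  then have "Poly_Mapping.lookup (mvar v :: ('v, 'a) mpoly) (Poly_Mapping.single v 1) = 0" by simp
  then show False by (simp add: mvar_def)
qed

text \<open>
  The equations are linear in the variables \<open>Y\<close> with coefficients that are polynomials in \<open>U\<close>. Solving
  them generically, by \<open>homogeneous_linear_system\<close>, gives an endomorphism \<open>\<phi>\<close> of the polynomial ring
  that fixes \<open>U\<close>, kills the equations and sends each free variable \<open>s\<close> to \<open>D * s\<close>. After \<open>\<phi>\<close> the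
  free variables and then the variables in \<open>U\<close> are set to zero one after the other. The kernels of these
  homomorphisms into a domain are primes, and each new variable set to zero makes the kernel larger. There
  are at least \<open>card Y - r\<close> free variables.
\<close>

theorem krull_dim_ge_of_linear_equations:
  fixes c :: "nat \<Rightarrow> 'v::linorder \<Rightarrow> ('v, 'a::idom) mpoly"
  assumes U: "finite U" and Y: "finite Y" and disj: "U \<inter> Y = {}"
    and c: "\<And>i y. i < r \<Longrightarrow> y \<in> Y \<Longrightarrow> c i y \<in> polys U"
    and I: "ideal I (mpoly_ring (U \<union> Y))"
    and sub: "I \<subseteq> Idl\<^bsub>mpoly_ring (U \<union> Y)\<^esub> ((\<lambda>i. \<Sum>y\<in>Y. c i y * mvar y) ` {..<r})"
  shows "ereal (real (card U + card Y - r)) \<le> krull_dim (mpoly_ring (U \<union> Y) Quot I)"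
proof -
  let ?V = "U \<union> Y"
  have "\<exists>S a D. S \<subseteq> Y \<and> card Y \<le> card S + r \<and> D \<in> (polys U :: ('v, 'a) mpoly set) \<and> D \<noteq> 0 \<and>
      (\<forall>v\<in>Y. \<forall>s\<in>S. a v s \<in> polys U) \<and>
      (\<forall>s\<in>S. \<forall>t\<in>S. a t s = (if t = s then D else 0)) \<and>
      (\<forall>i<r. \<forall>s\<in>S. (\<Sum>v\<in>Y. c i v * a v s) = 0)"
    by (rule homogeneous_linear_system[OF Y]) (auto intro: c)
  then obtain S a D where sol: "S \<subseteq> Y \<and> card Y \<le> card S + r \<and> D \<in> (polys U :: ('v, 'a) mpoly set) \<and> D \<noteq> 0 \<and>
      (\<forall>v\<in>Y. \<forall>s\<in>S. a v s \<in> polys U) \<and>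
      (\<forall>s\<in>S. \<forall>t\<in>S. a t s = (if t = s then D else 0)) \<and>
      (\<forall>i<r. \<forall>s\<in>S. (\<Sum>v\<in>Y. c i v * a v s) = 0)"
    by (elim exE)
  have SY: "S \<subseteq> Y" and cardS: "card Y \<le> card S + r" and D: "D \<in> polys U" "D \<noteq> 0"
    using sol by simp_all
  have delta: "a t s = (if t = s then D else 0)" if "s \<in> S" "t \<in> S" for s t
    using sol that by blast
  have zero: "(\<Sum>v\<in>Y. c i v * a v s) = 0" if "i < r" "s \<in> S" for i s
    using sol that by blast
  have fS: "finite S" using SY Y finite_subset by blast
  obtain ss where ss: "set ss = S" "distinct ss" using finite_distinct_list[OF fS] by blast
  obtain us where us: "set us = U" "distinct us" using finite_distinct_list[OF U] by blast
  define ws where "ws = ss @ us"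
  define \<phi> where "\<phi> v = (if v \<in> Y then \<Sum>s\<in>S. a v s * mvar s else mvar v)" for v
  define \<sigma> where "\<sigma> j v = (if v \<in> set (take j ws) then 0 else mvar v :: ('v, 'a) mpoly)" for j v
  define \<theta> where "\<theta> j v = subst (\<sigma> j) (\<phi> v)" for j v
  define P where "P j = {f \<in> polys ?V. subst (\<theta> j) f = 0}" for j
  have dist: "distinct ws" using ss us disj SY by (auto simp: ws_def)
  have len: "length ws = card S + card U"
    using ss us distinct_card by (metis length_append ws_def)
  have \<phi>U: "subst \<phi> f = f" if "f \<in> polys U" for f
  proof -
    have "subst \<phi> f = subst mvar f"
      by (rule subst_cong[OF that]) (use disj in \<open>auto simp: \<phi>_def\<close>)
    then show ?thesis by (simp add: subst_mvar_id)
  qed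
  have \<phi>S: "\<phi> s = D * mvar s" if s: "s \<in> S" for s
  proof -
    have "\<phi> s = (\<Sum>t\<in>S. a s t * mvar t)" using s SY by (auto simp: \<phi>_def)
    also have "\<dots> = (\<Sum>t\<in>S. if t = s then D * mvar t else 0)"
      by (rule sum.cong) (use delta s in auto)
    also have "\<dots> = D * mvar s" using s fS by simp
    finally show ?thesis .
  qed
  have eqs: "subst \<phi> (\<Sum>y\<in>Y. c i y * mvar y) = 0" if i: "i < r" for i
  proof -
    have "subst \<phi> (\<Sum>y\<in>Y. c i y * mvar y) = (\<Sum>y\<in>Y. c i y * (\<Sum>s\<in>S. a y s * mvar s))"
      unfolding subst_sum subst_mult subst_mvar
      by (rule sum.cong) (use i c \<phi>U in \<open>auto simp: \<phi>_def\<close>)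
    also have "\<dots> = (\<Sum>s\<in>S. (\<Sum>y\<in>Y. c i y * a y s) * mvar s)"
      unfolding sum_distrib_left sum_distrib_right by (subst sum.swap) (simp add: mult.assoc)
    also have "\<dots> = (\<Sum>s\<in>S. 0)" by (rule sum.cong) (simp_all add: zero[OF i])
    finally show ?thesis by simp
  qed
  have prime: "primeideal (P j) (mpoly_ring ?V)" for j
    unfolding P_def by (rule primeideal_kernel_subst)
  have contains: "I \<subseteq> P j" for j
  proof -
    have "(\<Sum>y\<in>Y. c i y * mvar y) \<in> P j" if "i < r" for i
    proof -
      have "c i y \<in> polys ?V" if "y \<in> Y" for y
        using c[OF \<open>i < r\<close> that] by (auto simp: polys_iff)
      moreover have "subst (\<theta> j) (\<Sum>y\<in>Y. c i y * mvar y) = 0"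
        unfolding \<theta>_def subst_subst[symmetric] eqs[OF that] by simp
      ultimately show ?thesis unfolding P_def by (auto intro!: polys_sum polys_mult)
    qed
    then have "Idl\<^bsub>mpoly_ring ?V\<^esub> ((\<lambda>i. \<Sum>y\<in>Y. c i y * mvar y) ` {..<r}) \<subseteq> P j"
      using prime by (intro genideal_mpoly_minimal) (auto simp: primeideal_def)
    then show ?thesis using sub by blast
  qed
  have strict: "P j \<subset> P (Suc j)" if j: "j < length ws" for j
  proof
    have "\<sigma> (Suc j) v = subst (\<sigma> (Suc j)) (\<sigma> j v)" for v
    proof (cases "v \<in> set (take j ws)")
      case True
      then have "v \<in> set (take (Suc j) ws)" using set_take_subset_set_take[of j "Suc j" ws] by auto
      then show ?thesis using True by (simp add: \<sigma>_def)
    qed (simp add: \<sigma>_def)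
    then have "\<sigma> (Suc j) = (\<lambda>v. subst (\<sigma> (Suc j)) (\<sigma> j v))" by blast
    then have step: "subst (\<sigma> (Suc j)) f = subst (\<sigma> (Suc j)) (subst (\<sigma> j) f)" for f
      unfolding subst_subst by simp
    have "subst (\<theta> (Suc j)) f = subst (\<sigma> (Suc j)) (subst (\<theta> j) f)" for f
      unfolding \<theta>_def subst_subst[symmetric] by (rule step)
    then show "P j \<subseteq> P (Suc j)" unfolding P_def by auto
    let ?w = "ws ! j"
    have wV: "?w \<in> ?V"
      using nth_mem[OF j] ss us SY by (auto simp: ws_def)
    have w1: "?w \<in> set (take (Suc j) ws)" using j by (simp add: take_Suc_conv_app_nth)
    have w0: "?w \<notin> set (take j ws)"
      using j by (auto simp: in_set_conv_nth nth_eq_iff_index_eq[OF dist])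
    have "subst (\<theta> j) (mvar ?w) \<noteq> 0 \<and> subst (\<theta> (Suc j)) (mvar ?w) = 0"
    proof (cases "j < length ss")
      case True
      then have wS: "?w \<in> S" using ss by (auto simp: ws_def nth_append)
      have "subst (\<sigma> j) D = D"
      proof -
        have "set (take j ws) \<subseteq> S" using True ss by (auto simp: ws_def dest: in_set_takeD)
        then have "subst (\<sigma> j) D = subst mvar D"
          using SY disj by (intro subst_cong[OF D(1)]) (auto simp: \<sigma>_def)
        then show ?thesis by (simp add: subst_mvar_id)
      qed
      then show ?thesis
        using w0 w1 D(2) by (simp add: \<theta>_def \<phi>S[OF wS] subst_mult \<sigma>_def)
    next
      case False
      then have "?w \<in> U" using us j by (auto simp: ws_def nth_append)
      then have "\<phi> ?w = mvar ?w" using disj by (auto simp: \<phi>_def)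
      then show ?thesis using w0 w1 by (simp add: \<theta>_def \<sigma>_def)
    qed
    then have "mvar ?w \<in> P (Suc j) - P j" using wV by (auto simp: P_def)
    then show "P j \<noteq> P (Suc j)" by blast
  qed
  have "prime_chain_above (mpoly_ring ?V) I (length ws) P"
    unfolding prime_chain_above_def using prime contains strict by blast
  then have "ereal (real (length ws)) \<le> krull_dim (mpoly_ring ?V Quot I)"
    unfolding cring.krull_dim_Quot[OF cring_mpoly_ring I] by (intro Sup_upper) blast
  moreover have "card U + card Y - r \<le> length ws" using cardS len by simp
  ultimately show ?thesis by (meson ereal_less_eq(3) of_nat_le_iff order_trans)
qed

section \<open>Quotients in which all variables are nilpotent\<close>

lemma subst_mono_zero: "subst_mono (\<lambda>_. 0) m = (if m = 0 then 1 else 0)"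
proof (cases "m = 0")
  case False
  then obtain v where "v \<in> Poly_Mapping.keys m" by (metis equals0I keys_eq_empty)
  then have "subst_mono (\<lambda>_. 0) m = 0"
    unfolding subst_mono_def by (intro prod_zero) (auto simp: in_keys_iff power_0_left)
  then show ?thesis using False by simp
qed (simp add: subst_mono_def)

lemma subst_zero_eq: "subst (\<lambda>_. 0) f = const (Poly_Mapping.lookup f 0)"
proof -
  have "subst (\<lambda>_. 0) f = (\<Sum>m\<in>Poly_Mapping.keys f. if m = 0 then const (Poly_Mapping.lookup f m) else 0)"
    unfolding subst_def by (rule sum.cong) (simp_all add: subst_mono_zero)
  also have "\<dots> = const (Poly_Mapping.lookup f 0)" by (simp add: in_keys_iff)
  finally show ?thesis .
qed

lemma const_eq_0_iff: "const c = 0 \<longleftrightarrow> c = 0"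
  by (metis lookup_single_eq lookup_zero single_zero)

text \<open>
  The homogeneous maximal ideal, generated by the variables.
\<close>

definition no_const :: "'v set \<Rightarrow> ('v, 'a::comm_ring_1) mpoly set" where
  "no_const V = {f \<in> polys V. Poly_Mapping.lookup f 0 = 0}"

text \<open>
  The constant coefficient is the value at the origin, so this ideal is the kernel of a substitution.
\<close>

lemma primeideal_no_const: "primeideal (no_const V :: ('v, 'a::idom) mpoly set) (mpoly_ring V)"
proof -
  have "(no_const V :: ('v, 'a) mpoly set) = {f \<in> polys V. subst (\<lambda>_. 0 :: (nat, 'a) mpoly) f = 0}"
    unfolding no_const_def subst_zero_eq const_eq_0_iff ..
  then show ?thesis by (simp only: primeideal_kernel_subst)
qed

lemma primeideal_containing_variables:
  fixes P :: "('v, 'a::field) mpoly set"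
  assumes P: "primeideal P (mpoly_ring V)" and vars: "\<And>v. v \<in> V \<Longrightarrow> mvar v \<in> P"
  shows "P = no_const V"
proof -
  have I: "ideal P (mpoly_ring V)" using P by (simp add: primeideal_def)
  have mono: "Poly_Mapping.single m c \<in> P" if m: "Poly_Mapping.keys m \<subseteq> V" "m \<noteq> 0" for m c
  proof -
    obtain v where v: "v \<in> Poly_Mapping.keys m" using m(2) by (metis equals0I keys_eq_empty)
    define m' where "m' = m - Poly_Mapping.single v 1"
    have "m = m' + Poly_Mapping.single v 1"
      by (rule poly_mapping_eqI)
        (use v in \<open>auto simp: m'_def lookup_add lookup_minus lookup_single when_def in_keys_iff\<close>)
    then have "Poly_Mapping.single m c = Poly_Mapping.single m' c * mvar v"
      by (simp add: mvar_def mult_single)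
    moreover have "Poly_Mapping.keys m' \<subseteq> V"
      using m(1) by (auto simp: m'_def in_keys_iff lookup_minus)
    moreover have "v \<in> V" using v m(1) by blast
    ultimately show ?thesis using ideal_mpoly_mult[OF I vars single_polys[of m' V c]] by simp
  qed
  have diff: "f - const (Poly_Mapping.lookup f 0) \<in> P" if f: "f \<in> polys V" for f
  proof -
    have "f = (\<Sum>m\<in>insert 0 (Poly_Mapping.keys f). Poly_Mapping.single m (Poly_Mapping.lookup f m))"
      by (subst mpoly_expand) (rule sum.mono_neutral_left, auto simp: in_keys_iff)
    also have "\<dots> = const (Poly_Mapping.lookup f 0) +
        (\<Sum>m\<in>Poly_Mapping.keys f - {0}. Poly_Mapping.single m (Poly_Mapping.lookup f m))"
      by (simp add: sum.insert_remove)
    finally have "f - const (Poly_Mapping.lookup f 0) =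
        (\<Sum>m\<in>Poly_Mapping.keys f - {0}. Poly_Mapping.single m (Poly_Mapping.lookup f m))"
      by (metis add_diff_cancel_left')
    also have "\<dots> \<in> P" by (rule ideal_mpoly_sum[OF I]) (use f mono in \<open>auto simp: polys_iff\<close>)
    finally show ?thesis .
  qed
  show ?thesis
  proof
    show "no_const V \<subseteq> P"
    proof
      fix f :: "('v, 'a) mpoly" assume "f \<in> no_const V"
      then show "f \<in> P" using diff[of f] by (simp add: no_const_def)
    qed
    show "P \<subseteq> no_const V"
    proof
      fix f assume fP: "f \<in> P"
      then have f: "f \<in> polys V" using ideal_mpoly_subset[OF I] by simp
      let ?c = "Poly_Mapping.lookup f 0"
      have "const ?c \<in> P" using ideal_mpoly_diff[OF I fP diff[OF f]] by simp
      then have "const (inverse ?c) * const ?c \<in> P" by (rule ideal_mpoly_mult[OF I]) simp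
      then have "?c = 0" using primeideal_mpoly_1[OF P]
        by (cases "?c = 0") (auto simp: mult_single)
      then show "f \<in> no_const V" using f by (simp add: no_const_def)
    qed
  qed
qed

lemma homogeneous_no_const:
  assumes "homogeneous d f" "d > 0" "f \<in> polys V"
  shows "f \<in> no_const V"
proof -
  have "0 \<notin> Poly_Mapping.keys f"
  proof
    assume "0 \<in> Poly_Mapping.keys f"
    then have "mdeg (0 :: 'a \<Rightarrow>\<^sub>0 nat) = d" using assms(1) unfolding homogeneous_def by blast
    then show False using assms(2) by simp
  qed
  then show ?thesis using assms(3) by (simp add: no_const_def in_keys_iff)
qed

text \<open>
  Every prime above the parameters contains all variables and is therefore the homogeneous maximal
  ideal; this ideal does contain them, since all generators have positive degree.
\<close>

lemma krull_dim_zero_of_nilpotent_variables: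
  fixes S T :: "('v, 'a::field) mpoly set"
  assumes S: "S \<subseteq> polys V" "\<And>s. s \<in> S \<Longrightarrow> \<exists>d>0. homogeneous d s"
    and T: "T \<subseteq> polys V" "\<And>s. s \<in> T \<Longrightarrow> \<exists>d>0. homogeneous d s"
    and nil: "\<And>v. v \<in> V \<Longrightarrow> \<exists>n. mvar v ^ n \<in> Idl\<^bsub>mpoly_ring V\<^esub> (S \<union> T)"
    and A: "A = mpoly_ring V Quot Idl\<^bsub>mpoly_ring V\<^esub> S"
  shows "krull_dim (A Quot Idl\<^bsub>A\<^esub> ((\<lambda>f. Idl\<^bsub>mpoly_ring V\<^esub> S +>\<^bsub>mpoly_ring V\<^esub> f) ` T)) = 0"
proof -
  let ?R = "mpoly_ring V :: ('v, 'a) mpoly ring"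
  let ?I = "Idl\<^bsub>?R\<^esub> S"
  let ?T = "(\<lambda>f. ?I +>\<^bsub>?R\<^esub> f) ` T"
  interpret R: cring ?R by (rule cring_mpoly_ring)
  have I: "ideal ?I ?R" by (rule ideal_genideal_mpoly[OF S(1)])
  interpret I: ideal ?I ?R by (rule I)
  interpret A: cring A unfolding A by (rule ideal.quotient_is_cring[OF I R.is_cring])
  have TA: "?T \<subseteq> carrier A"
    using T(1) unfolding A FactRing_def A_RCOSETS_def'[of ?R ?I] by auto
  have K: "ideal (Idl\<^bsub>A\<^esub> ?T) A" by (rule A.genideal_ideal[OF TA])
  have M: "primeideal (no_const V) ?R" by (rule primeideal_no_const)
  have SM: "S \<subseteq> no_const V" using S homogeneous_no_const by blast
  have IM: "?I \<subseteq> no_const V"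
    using M SM by (intro genideal_mpoly_minimal) (auto simp: primeideal_def)
  have unique: "Q = (\<lambda>f. ?I +>\<^bsub>?R\<^esub> f) ` no_const V"
    if Q: "primeideal Q A" "Idl\<^bsub>A\<^esub> ?T \<subseteq> Q" for Q
  proof -
    note U = R.primeideal_Union_of_quotient[OF I Q(1)[unfolded A]]
    have Ui: "ideal (\<Union>Q) ?R" using U(1) by (simp add: primeideal_def)
    have "T \<subseteq> \<Union>Q"
    proof
      fix f assume f: "f \<in> T"
      then have "?I +>\<^bsub>?R\<^esub> f \<in> Q" using A.genideal_self[OF TA] Q(2) by blast
      moreover have "f \<in> ?I +>\<^bsub>?R\<^esub> f"
        using f T(1) by (intro I.a_rcos_self) auto
      ultimately show "f \<in> \<Union>Q" by blast
    qed
    moreover have "S \<subseteq> \<Union>Q" using U(2) genideal_mpoly_self[OF S(1)] by blast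
    ultimately have J: "Idl\<^bsub>?R\<^esub> (S \<union> T) \<subseteq> \<Union>Q"
      by (intro genideal_mpoly_minimal[OF Ui]) blast
    have "mvar v \<in> \<Union>Q" if "v \<in> V" for v
      using nil[OF that] J primeideal_mpoly_power[OF U(1) polys_mvar[OF that]] by blast
    then have "\<Union>Q = no_const V" by (rule primeideal_containing_variables[OF U(1)])
    then show ?thesis using U(3) by simp
  qed
  let ?Q = "(\<lambda>f. ?I +>\<^bsub>?R\<^esub> f) ` no_const V"
  have Q: "primeideal ?Q A"
    unfolding A by (rule R.primeideal_image_in_quotient(1)[OF M I IM])
  have TM: "T \<subseteq> no_const V" using T homogeneous_no_const by blast
  have KQ: "Idl\<^bsub>A\<^esub> ?T \<subseteq> ?Q"
    using Q TM by (intro A.genideal_minimal) (auto simp: primeideal_def)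
  have "(\<exists>P. prime_chain_above A (Idl\<^bsub>A\<^esub> ?T) m P) \<longleftrightarrow> m = 0" for m
  proof
    assume "\<exists>P. prime_chain_above A (Idl\<^bsub>A\<^esub> ?T) m P"
    then obtain P where P: "prime_chain_above A (Idl\<^bsub>A\<^esub> ?T) m P" by blast
    show "m = 0"
    proof (rule ccontr)
      assume "m \<noteq> 0"
      then have "P 0 = ?Q" "P (Suc 0) = ?Q" "P 0 \<subset> P (Suc 0)"
        using P unfolding prime_chain_above_def by (auto intro!: unique)
      then show False by simp
    qed
  next
    assume "m = 0"
    then show "\<exists>P. prime_chain_above A (Idl\<^bsub>A\<^esub> ?T) m P"
      using Q KQ by (intro exI[of _ "\<lambda>_. ?Q"]) (simp add: prime_chain_above_def)
  qed
  then show ?thesis unfolding A.krull_dim_Quot[OF K] by simp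
qed

section \<open>Radicals\<close>

lemma of_nat_polys [simp]: "of_nat n \<in> polys V"
  by (induction n) auto

lemma ideal_radical:
  fixes J :: "('v, 'a::comm_ring_1) mpoly set"
  assumes J: "ideal J (mpoly_ring V)"
  shows "ideal {f \<in> polys V. \<exists>n. f ^ n \<in> J} (mpoly_ring V)"
proof (rule ideal_mpolyI)
  show "0 \<in> {f \<in> polys V. \<exists>n. f ^ n \<in> J}"
    using ideal_mpoly_0[OF J] by (auto intro!: exI[of _ 1])
next
  fix f g assume "f \<in> {f \<in> polys V. \<exists>n. f ^ n \<in> J}" "g \<in> {f \<in> polys V. \<exists>n. f ^ n \<in> J}"
  then obtain a b where f: "f \<in> polys V" "f ^ a \<in> J" and g: "g \<in> polys V" "g ^ b \<in> J" by blast
  have "(f + g) ^ (a + b) \<in> J"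
    unfolding binomial_ring
  proof (rule ideal_mpoly_sum[OF J])
    fix i assume i: "i \<in> {..a + b}"
    show "of_nat (a + b choose i) * f ^ i * g ^ (a + b - i) \<in> J"
    proof (cases "a \<le> i")
      case True
      then have "of_nat (a + b choose i) * f ^ i * g ^ (a + b - i) =
          (of_nat (a + b choose i) * f ^ (i - a) * g ^ (a + b - i)) * f ^ a"
        using power_add[of f "i - a" a] by (simp add: mult_ac)
      then show ?thesis using ideal_mpoly_mult[OF J f(2)] f(1) g(1) by (simp add: polys_mult polys_power)
    next
      case False
      then have "of_nat (a + b choose i) * f ^ i * g ^ (a + b - i) =
          (of_nat (a + b choose i) * f ^ i * g ^ (a - i)) * g ^ b"
        using power_add[of g "a - i" b] by (simp add: mult_ac)
      then show ?thesis using ideal_mpoly_mult[OF J g(2)] f(1) g(1) by (simp add: polys_mult polys_power)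
    qed
  qed
  then show "f + g \<in> {f \<in> polys V. \<exists>n. f ^ n \<in> J}" using f g by auto
next
  fix f h :: "('v, 'a) mpoly" assume "f \<in> {f \<in> polys V. \<exists>n. f ^ n \<in> J}" and h: "h \<in> polys V"
  then obtain n where f: "f \<in> polys V" "f ^ n \<in> J" by blast
  then have "(h * f) ^ n \<in> J"
    using ideal_mpoly_mult[OF J f(2) polys_power[OF h]] by (simp add: power_mult_distrib)
  then show "h * f \<in> {f \<in> polys V. \<exists>n. f ^ n \<in> J}" using f h by auto
qed auto

section \<open>A criterion for homogeneous systems of parameters\<close>

text \<open>
  Nilpotency of the variables already bounds the dimension from above by the number of parameters, so
  only the lower bound remains as a hypothesis on the dimension.
\<close>

theorem hsop_of_nilpotent_variables:
  fixes S :: "('v, 'a::field) mpoly set"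
  assumes V: "finite V"
    and S: "finite S" "S \<subseteq> polys V" "\<And>s. s \<in> S \<Longrightarrow> \<exists>d>0. homogeneous d s"
    and fs: "distinct fs" "set fs \<subseteq> polys V" "\<And>f. f \<in> set fs \<Longrightarrow> \<exists>d>0. homogeneous d f"
    and nil: "\<And>v. v \<in> V \<Longrightarrow> \<exists>n. mvar v ^ n \<in> Idl\<^bsub>mpoly_ring V\<^esub> (S \<union> set fs)"
    and dim: "ereal (real (length fs)) \<le> krull_dim (mpoly_ring V Quot Idl\<^bsub>mpoly_ring V\<^esub> S)"
  shows "hsop V (Idl\<^bsub>mpoly_ring V\<^esub> S) (map (\<lambda>f. Idl\<^bsub>mpoly_ring V\<^esub> S +>\<^bsub>mpoly_ring V\<^esub> f) fs)"
  unfolding hsop_def Let_def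
proof (intro conjI)
  show "homogeneous_ideal V (Idl\<^bsub>mpoly_ring V\<^esub> S)"
    unfolding homogeneous_ideal_def using S by (intro exI[of _ S]) blast
  show "\<forall>w\<in>set (map (\<lambda>f. Idl\<^bsub>mpoly_ring V\<^esub> S +>\<^bsub>mpoly_ring V\<^esub> f) fs).
      \<exists>d>0. \<exists>f\<in>carrier (mpoly_ring V). homogeneous d f \<and> w = Idl\<^bsub>mpoly_ring V\<^esub> S +>\<^bsub>mpoly_ring V\<^esub> f"
    using fs(2,3) by fastforce
  have "krull_dim (mpoly_ring V Quot Idl\<^bsub>mpoly_ring V\<^esub> S) \<le> card (set fs)"
    by (rule krull_dim_le_card_parameters[OF V S(1,2) _ finite_set fs(2,3) nil]) (use S(3) in auto)
  then show "ereal (real (length (map (\<lambda>f. Idl\<^bsub>mpoly_ring V\<^esub> S +>\<^bsub>mpoly_ring V\<^esub> f) fs))) =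
      krull_dim (mpoly_ring V Quot Idl\<^bsub>mpoly_ring V\<^esub> S)"
    using dim by (simp add: distinct_card[OF fs(1)])
  show "krull_dim (mpoly_ring V Quot Idl\<^bsub>mpoly_ring V\<^esub> S Quot
      Idl\<^bsub>mpoly_ring V Quot Idl\<^bsub>mpoly_ring V\<^esub> S\<^esub> set (map (\<lambda>f. Idl\<^bsub>mpoly_ring V\<^esub> S +>\<^bsub>mpoly_ring V\<^esub> f) fs)) = 0"
    unfolding set_map
    by (rule krull_dim_zero_of_nilpotent_variables[OF S(2,3) fs(2,3) nil refl])
qed

section \<open>The entries of the commutator\<close>

text \<open>
  Polynomials form an integral domain by a type class instance that asks for a linear order on the
  variables. The order is the one of an enumeration.
\<close>

instance mat_var :: countable
  by countable_datatype

instantiation mat_var :: linorder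
begin
definition less_eq_mat_var_def: "(v :: mat_var) \<le> w \<longleftrightarrow> to_nat v \<le> to_nat w"
definition less_mat_var_def: "(v :: mat_var) < w \<longleftrightarrow> to_nat v < to_nat w"
instance by standard (auto simp: less_eq_mat_var_def less_mat_var_def)
end

lemma vx_polys [simp]: "i \<in> {1..n} \<Longrightarrow> j \<in> {1..n} \<Longrightarrow> vx i j \<in> polys (mat_vars n)"
  unfolding vx_def by (rule polys_mvar) (auto simp: mat_vars_def)

lemma vy_polys [simp]: "i \<in> {1..n} \<Longrightarrow> j \<in> {1..n} \<Longrightarrow> vy i j \<in> polys (mat_vars n)"
  unfolding vy_def by (rule polys_mvar) (auto simp: mat_vars_def)

lemma comm_entry_polys: "i \<in> {1..n} \<Longrightarrow> j \<in> {1..n} \<Longrightarrow> comm_entry n i j \<in> polys (mat_vars n)"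
  unfolding comm_entry_def by (intro polys_diff polys_sum polys_mult vx_polys vy_polys)

lemma homogeneous_diff: "homogeneous d f \<Longrightarrow> homogeneous d g \<Longrightarrow> homogeneous d (f - g)"
  using keys_diff[of f g] unfolding homogeneous_def by blast

lemma homogeneous_add: "homogeneous d f \<Longrightarrow> homogeneous d g \<Longrightarrow> homogeneous d (f + g)"
  using keys_add[of f g] unfolding homogeneous_def by blast

lemma homogeneous_sum: "(\<And>x. x \<in> A \<Longrightarrow> homogeneous d (F x)) \<Longrightarrow> homogeneous d (sum F A)"
  by (induction A rule: infinite_finite_induct) (auto intro: homogeneous_add simp: homogeneous_def[of d 0])

lemma homogeneous_mvar: "homogeneous 1 (mvar v)"
  by (auto simp: homogeneous_def mvar_def mdeg_def)

lemma homogeneous_comm_entry: "homogeneous 2 (comm_entry n i j)"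
  unfolding comm_entry_def vx_def vy_def
  using homogeneous_mult[OF homogeneous_mvar homogeneous_mvar]
  by (intro homogeneous_diff homogeneous_sum) (simp_all only: one_add_one)

lemma trace_commutator: "(\<Sum>i=1..n. comm_entry n i i) = (0 :: 'a::comm_ring_1 mat_poly)"
proof -
  have "(\<Sum>i=1..n. \<Sum>l=1..n. vy i l * vx l i) = (\<Sum>i=1..n. \<Sum>l=1..n. vx i l * (vy l i :: 'a mat_poly))"
    by (subst sum.swap) (simp add: mult.commute)
  then show ?thesis by (simp add: comm_entry_def sum_subtractf)
qed

definition xvars :: "nat \<Rightarrow> mat_var set" where
  "xvars n = case_prod XVar ` ({1..n} \<times> {1..n})"
definition yvars :: "nat \<Rightarrow> mat_var set" where
  "yvars n = case_prod YVar ` ({1..n} \<times> {1..n})"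

lemma mat_vars_eq: "mat_vars n = xvars n \<union> yvars n"
  unfolding mat_vars_def xvars_def yvars_def by auto

lemma card_xvars: "card (xvars n) = n * n" and card_yvars: "card (yvars n) = n * n"
  unfolding xvars_def yvars_def by (subst card_image; auto simp: inj_on_def)+

fun comm_coeff :: "nat \<Rightarrow> nat \<Rightarrow> mat_var \<Rightarrow> 'a::comm_ring_1 mat_poly" where
  "comm_coeff i j (YVar p q) = (if q = j then vx i p else 0) - (if p = i then vx q j else 0)"
| "comm_coeff i j (XVar p q) = 0"

lemma comm_entry_linear:
  assumes "i \<in> {1..n}" "j \<in> {1..n}"
  shows "comm_entry n i j = (\<Sum>y\<in>yvars n. comm_coeff i j y * mvar y)"
proof -
  have "(\<Sum>y\<in>yvars n. comm_coeff i j y * mvar y) =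
      (\<Sum>p=1..n. \<Sum>q=1..n. comm_coeff i j (YVar p q) * vy p q)"
    unfolding yvars_def by (subst sum.reindex) (auto simp: inj_on_def vy_def sum.cartesian_product case_prod_unfold)
  also have "\<dots> = (\<Sum>p=1..n. \<Sum>q=1..n. if q = j then vx i p * vy p q else 0) -
      (\<Sum>p=1..n. \<Sum>q=1..n. if p = i then vx q j * vy p q else 0)"
    unfolding sum_subtractf[symmetric] by (intro sum.cong refl) (auto simp: left_diff_distrib)
  also have "(\<Sum>p=1..n. \<Sum>q=1..n. if p = i then vx q j * vy p q else 0) =
      (\<Sum>q=1..n. \<Sum>p=1..n. if p = i then vx q j * vy p q else (0::'a mat_poly))"
    by (rule sum.swap)
  finally show ?thesis using assms by (simp add: comm_entry_def mult.commute)
qed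

lemma vx_xvars: "i \<in> {1..n} \<Longrightarrow> j \<in> {1..n} \<Longrightarrow> vx i j \<in> polys (xvars n)"
  unfolding vx_def by (rule polys_mvar) (force simp: xvars_def)

lemma comm_coeff_polys: "i \<in> {1..n} \<Longrightarrow> j \<in> {1..n} \<Longrightarrow> y \<in> yvars n \<Longrightarrow> comm_coeff i j y \<in> polys (xvars n)"
  by (auto simp: yvars_def intro!: polys_diff polys_minus vx_xvars)

text \<open>
  The \<open>2 * n\<close> generators are linear in the variables of \<open>Y\<close>. Since the trace of a commutator vanishes,
  the last diagonal entry is a combination of the others, and \<open>2 * n - 1\<close> equations remain.
\<close>

theorem krull_dim_diag_antidiag_ge:
  assumes n: "n \<ge> 1"
  shows "ereal (real (2 * n * n - (2 * n - 1))) \<le>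
    krull_dim (mpoly_ring (mat_vars n) Quot (diag_antidiag_ideal n :: 'a::idom mat_poly set))"
proof -
  let ?V = "xvars n \<union> yvars n"
  define I where "I = (diag_antidiag_ideal n :: 'a mat_poly set)"
  \<comment> \<open>The first \<open>n - 1\<close> equations are diagonal entries, the other \<open>n\<close> anti-diagonal ones.\<close>
  define pos where "pos t = (if t < n - 1 then (t + 1, t + 1) else (t - (n - 1) + 1, n - (t - (n - 1))))" for t
  define c where "c t = (comm_coeff (fst (pos t)) (snd (pos t)) :: _ \<Rightarrow> 'a mat_poly)" for t
  define F where "F = (\<lambda>t. \<Sum>y\<in>yvars n. c t y * mvar y) ` {..<2 * n - 1}"
  have range: "fst (pos t) \<in> {1..n}" "snd (pos t) \<in> {1..n}" if "t < 2 * n - 1" for t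
    using that n by (auto simp: pos_def)
  have cp: "c t y \<in> polys (xvars n)" if "t < 2 * n - 1" "y \<in> yvars n" for t y
    unfolding c_def by (rule comm_coeff_polys[OF range[OF that(1)] that(2)])
  have ct: "(\<Sum>y\<in>yvars n. c t y * mvar y) = comm_entry n (fst (pos t)) (snd (pos t))" if "t < 2 * n - 1" for t
    unfolding c_def by (rule comm_entry_linear[OF range[OF that], symmetric])
  have F: "comm_entry n (fst (pos t)) (snd (pos t)) \<in> F" if "t < 2 * n - 1" for t
    unfolding F_def using ct[OF that] that by force
  have FV: "F \<subseteq> polys ?V"
  proof
    fix f assume "f \<in> F"
    then obtain t where t: "t < 2 * n - 1" "f = (\<Sum>y\<in>yvars n. c t y * mvar y)" unfolding F_def by blast
    then have "f = comm_entry n (fst (pos t)) (snd (pos t))" using ct by simp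
    then show "f \<in> polys ?V" using comm_entry_polys[OF range[OF t(1)]] by (simp add: mat_vars_eq)
  qed
  have IF: "ideal (Idl\<^bsub>mpoly_ring ?V\<^esub> F) (mpoly_ring ?V)" by (rule ideal_genideal_mpoly[OF FV])
  have diag: "comm_entry n i i \<in> Idl\<^bsub>mpoly_ring ?V\<^esub> F" if "i \<in> {1..n - 1}" for i
  proof -
    have "pos (i - 1) = (i, i)" "i - 1 < 2 * n - 1" using that by (auto simp: pos_def)
    then show ?thesis using F[of "i - 1"] genideal_mpoly_self[OF FV] by simp
  qed
  have last: "comm_entry n n n \<in> Idl\<^bsub>mpoly_ring ?V\<^esub> F"
  proof -
    have "(\<Sum>i=1..n. comm_entry n i i) = (\<Sum>i=1..n-1. comm_entry n i i) + (comm_entry n n n :: 'a mat_poly)"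
      using n by (cases n) auto
    then have "comm_entry n n n = - (\<Sum>i=1..n-1. comm_entry n i i :: 'a mat_poly)"
      using trace_commutator[of n] by (metis add.commute eq_neg_iff_add_eq_0)
    moreover have "(\<Sum>i=1..n-1. comm_entry n i i) \<in> Idl\<^bsub>mpoly_ring ?V\<^esub> F"
      by (rule ideal_mpoly_sum[OF IF diag])
    ultimately show ?thesis using ideal_mpoly_minus[OF IF] by simp
  qed
  have anti: "comm_entry n i (n + 1 - i) \<in> Idl\<^bsub>mpoly_ring ?V\<^esub> F" if "i \<in> {1..n}" for i
  proof -
    have "pos (n - 1 + (i - 1)) = (i, n + 1 - i)" "n - 1 + (i - 1) < 2 * n - 1"
      using that by (auto simp: pos_def)
    then show ?thesis using F[of "n - 1 + (i - 1)"] genideal_mpoly_self[OF FV] by simp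
  qed
  have gens: "{comm_entry n i i | i. i \<in> {1..n}} \<union> {comm_entry n i (n + 1 - i) | i. i \<in> {1..n}}
      \<subseteq> Idl\<^bsub>mpoly_ring ?V\<^esub> F"
  proof -
    have "comm_entry n i i \<in> Idl\<^bsub>mpoly_ring ?V\<^esub> F" if "i \<in> {1..n}" for i
      using that diag[of i] last by (cases "i = n") auto
    then show ?thesis using anti by blast
  qed
  have I: "ideal I (mpoly_ring ?V)"
    unfolding I_def diag_antidiag_ideal_def mat_vars_eq
    using gens ideal_mpoly_subset[OF IF] by (intro ideal_genideal_mpoly) blast
  have "I \<subseteq> Idl\<^bsub>mpoly_ring ?V\<^esub> F"
    unfolding I_def diag_antidiag_ideal_def mat_vars_eq by (rule genideal_mpoly_minimal[OF IF gens])
  moreover have "finite (xvars n)" "finite (yvars n)" "xvars n \<inter> yvars n = {}"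
    by (auto simp: xvars_def yvars_def)
  ultimately have "ereal (real (card (xvars n) + card (yvars n) - (2 * n - 1))) \<le> krull_dim (mpoly_ring ?V Quot I)"
    unfolding F_def using cp I by (intro krull_dim_ge_of_linear_equations)
  then show ?thesis by (simp add: card_xvars card_yvars I_def mat_vars_eq mult_2 distrib_right)
qed

section \<open>The variables modulo the parameters\<close>

text \<open>
  The elementary step of the elimination. If a commutator entry lies in \<open>N\<close> and so do all of its
  products but one, then the remaining product does as well; if moreover its two factors agree modulo \<open>N\<close>,
  it is a square modulo \<open>N\<close>. Here \<open>N\<close> is a radical ideal, and the remaining product is
  \<open>vx i m * vy m j\<close>; in \<open>isolate_y\<close> it is \<open>vy i m * vx m j\<close>.
\<close>

lemma isolate_x:
  fixes N :: "'a::comm_ring_1 mat_poly set"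
  assumes N: "ideal N (mpoly_ring (mat_vars n))"
    and sq: "\<And>z. z \<in> polys (mat_vars n) \<Longrightarrow> z * z \<in> N \<Longrightarrow> z \<in> N"
    and ij: "i \<in> {1..n}" "j \<in> {1..n}" and c: "comm_entry n i j \<in> N"
    and m: "m \<in> {1..n}" and eq: "vx i m - vy m j \<in> N"
    and xs: "\<And>l. l \<in> {1..n} \<Longrightarrow> l \<noteq> m \<Longrightarrow> vx i l \<in> N \<or> vy l j \<in> N"
    and ys: "\<And>l. l \<in> {1..n} \<Longrightarrow> vy i l \<in> N \<or> vx l j \<in> N"
  shows "vx i m \<in> N \<and> vy m j \<in> N"
proof -
  note mult = ideal_mpoly_mult[OF N] ideal_mpoly_mult'[OF N]
  have "(\<Sum>l=1..n. vx i l * (vy l j :: 'a mat_poly)) = vx i m * vy m j + (\<Sum>l\<in>{1..n} - {m}. vx i l * vy l j)"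
    using m by (simp add: sum.remove)
  then have "vx i m * (vy m j :: 'a mat_poly) =
      comm_entry n i j + (\<Sum>l=1..n. vy i l * vx l j) - (\<Sum>l\<in>{1..n} - {m}. vx i l * vy l j)"
    by (simp only: comm_entry_def diff_add_cancel add_diff_cancel_right')
  also have "\<dots> \<in> N"
  proof (intro ideal_mpoly_diff[OF N] ideal_mpoly_add[OF N] c ideal_mpoly_sum[OF N])
    fix l assume l: "l \<in> {1..n}"
    show "vy i l * vx l j \<in> N" using ys[OF l] mult ij l by auto
  next
    fix l assume l: "l \<in> {1..n} - {m}"
    show "vx i l * vy l j \<in> N" using xs[of l] mult ij l by auto
  qed
  finally have prod: "vx i m * vy m j \<in> N" .
  have "vx i m * (vx i m :: 'a mat_poly) = vx i m * vy m j + vx i m * (vx i m - vy m j)" by (simp add: algebra_simps)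
  also have "\<dots> \<in> N" using prod eq mult ij m by (intro ideal_mpoly_add[OF N]) auto
  finally have x: "vx i m \<in> N" using sq ij m by auto
  have "(vy m j :: 'a mat_poly) = vx i m - (vx i m - vy m j)" by simp
  also have "\<dots> \<in> N" by (rule ideal_mpoly_diff[OF N x eq])
  finally show ?thesis using x by simp
qed

lemma isolate_y:
  fixes N :: "'a::comm_ring_1 mat_poly set"
  assumes N: "ideal N (mpoly_ring (mat_vars n))"
    and sq: "\<And>z. z \<in> polys (mat_vars n) \<Longrightarrow> z * z \<in> N \<Longrightarrow> z \<in> N"
    and ij: "i \<in> {1..n}" "j \<in> {1..n}" and c: "comm_entry n i j \<in> N"
    and m: "m \<in> {1..n}" and eq: "vx m j - vy i m \<in> N"
    and xs: "\<And>l. l \<in> {1..n} \<Longrightarrow> vx i l \<in> N \<or> vy l j \<in> N"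
    and ys: "\<And>l. l \<in> {1..n} \<Longrightarrow> l \<noteq> m \<Longrightarrow> vy i l \<in> N \<or> vx l j \<in> N"
  shows "vx m j \<in> N \<and> vy i m \<in> N"
proof -
  note mult = ideal_mpoly_mult[OF N] ideal_mpoly_mult'[OF N]
  have "(\<Sum>l=1..n. vy i l * (vx l j :: 'a mat_poly)) = vy i m * vx m j + (\<Sum>l\<in>{1..n} - {m}. vy i l * vx l j)"
    using m by (simp add: sum.remove)
  then have "vy i m * (vx m j :: 'a mat_poly) =
      (\<Sum>l=1..n. vx i l * vy l j) - comm_entry n i j - (\<Sum>l\<in>{1..n} - {m}. vy i l * vx l j)"
    by (simp only: comm_entry_def diff_diff_eq2 add_diff_cancel_left' add_diff_cancel_right')
  also have "\<dots> \<in> N"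
  proof (intro ideal_mpoly_diff[OF N] c ideal_mpoly_sum[OF N])
    fix l assume l: "l \<in> {1..n}"
    show "vx i l * vy l j \<in> N" using xs[OF l] mult ij l by auto
  next
    fix l assume l: "l \<in> {1..n} - {m}"
    show "vy i l * vx l j \<in> N" using ys[of l] mult ij l by auto
  qed
  finally have prod: "vy i m * vx m j \<in> N" .
  have "vx m j * (vx m j :: 'a mat_poly) = vy i m * vx m j + vx m j * (vx m j - vy i m)" by (simp add: algebra_simps)
  also have "\<dots> \<in> N" using prod eq mult ij m by (intro ideal_mpoly_add[OF N]) auto
  finally have x: "vx m j \<in> N" using sq ij m by auto
  have "(vy i m :: 'a mat_poly) = vx m j - (vx m j - vy i m)" by simp
  also have "\<dots> \<in> N" by (rule ideal_mpoly_diff[OF N x eq])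
  finally show ?thesis using x by simp
qed

text \<open>
  Outside \<open>Omega2\<close> there are the row \<open>k\<close> without three entries around the diagonal, parts of the rows
  \<open>k + 1\<close> and \<open>k + 2\<close>, and the lower part of the column \<open>k\<close>. The bounds are written without
  subtraction, which suits linear arithmetic on natural numbers.
\<close>

lemma not_Omega2:
  assumes "k \<ge> 2" "i \<in> {1..2*k}" "j \<in> {1..2*k}" "(i, j) \<notin> Omega2 k"
  shows "i = k \<and> (j + 2 \<le> k \<or> j \<ge> k + 2) \<or> i = k + 1 \<and> (j \<le> k \<or> j = k + 2) \<or>
    i = k + 2 \<and> (j + 1 = k \<or> j = k \<or> j = k + 1) \<or> i \<ge> k + 3 \<and> j = k"
proof -
  have "i \<le> k - 1 \<or> i = k \<or> i = k + 1 \<or> i = k + 2 \<or> i \<ge> k + 3" by linarith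
  then show ?thesis using assms by (elim disjE) (simp_all add: Omega2_def, linarith+)
qed

lemma parametersI:
  shows "(i, j) \<in> Omega2 k \<Longrightarrow> vx i j \<in> parameters k"
    and "(i, j) \<in> Omega2 k \<Longrightarrow> vy j i \<in> parameters k"
    and "1 \<le> s \<and> s \<le> k - 2 \<or> k + 3 \<le> s \<and> s \<le> 2 * k \<Longrightarrow> vx k s - vy (2 * k + 1 - s) k \<in> parameters k"
    and "1 \<le> s \<and> s \<le> k - 2 \<Longrightarrow> vx (k + 1) s - vy s (k + 1) \<in> parameters k"
    and "k + 3 \<le> s \<and> s \<le> 2 * k \<Longrightarrow> vx s k - vy k s \<in> parameters k"
    and "vx k (k + 2) - vy (k + 2) k \<in> parameters k"
    and "vx (k + 1) (k - 1) - vy (k + 2) (k + 1) \<in> parameters k"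
    and "vx (k + 1) k - vy k (k + 1) \<in> parameters k"
    and "vx (k + 1) (k + 2) - vy (k - 1) (k + 1) \<in> parameters k"
    and "vx (k + 2) (k - 1) - vy (k - 1) (k + 2) \<in> parameters k"
    and "vx (k + 2) k - vy (k + 1) (k + 2) \<in> parameters k"
    and "vx (k + 2) (k + 1) - vy k (k + 2) \<in> parameters k"
  unfolding parameters_def
  subgoal by (rule UnI1, rule UnI1, rule UnI1, rule UnI1, rule UnI1) blast
  subgoal by (rule UnI1, rule UnI1, rule UnI1, rule UnI1, rule UnI2) blast
  subgoal by (rule UnI1, rule UnI1, rule UnI1, rule UnI2) blast
  subgoal by (rule UnI1, rule UnI1, rule UnI2) blast
  subgoal by (rule UnI1, rule UnI2) blast
  by (rule UnI2, simp only: insert_iff simp_thms)+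

text \<open>
  Modulo the parameters, the variables at positions in \<open>Omega2\<close> (transposed for \<open>Y\<close>) vanish, and each
  remaining variable of \<open>X\<close> is identified with a remaining variable of \<open>Y\<close>. In a suitable order, each
  of the following entries of the commutator is, up to sign and up to terms that are already known to
  vanish, the square of the variable listed with it:

  \<^item> \<open>c i (2 k + 1 - i)\<close> for \<open>i \<le> k - 2\<close> and \<open>i \<ge> k + 3\<close>: the variable \<open>x k (2 k + 1 - i)\<close>;
  \<^item> \<open>c (k - 1) (k + 2)\<close> and \<open>c (k + 2) (k - 1)\<close>: \<open>x (k + 1) (k + 2)\<close> and \<open>x (k + 1) (k - 1)\<close>;
  \<^item> \<open>c i i\<close> for \<open>i \<le> k - 2\<close> and for \<open>i \<ge> k + 3\<close>: \<open>x (k + 1) i\<close> and \<open>x i k\<close>;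
  \<^item> \<open>c (k - 1) (k - 1)\<close>, \<open>c (k + 1) k\<close>, \<open>c k (k + 1)\<close>: \<open>x (k + 2) (k - 1)\<close>, \<open>x (k + 2) k\<close>,
    \<open>x (k + 2) (k + 1)\<close>;
  \<^item> \<open>c (k + 2) (k + 2)\<close> and \<open>c (k + 1) (k + 1)\<close>: \<open>x k (k + 2)\<close> and \<open>x (k + 1) k\<close>.

  The facts \<open>X0\<close>, \<open>X1\<close>, \<open>X2\<close> (and \<open>Y0\<close>, \<open>Y1\<close>, \<open>Y2\<close>) record where a variable can still be
  nonzero at the beginning, after the first two of these steps, and after the first four.
\<close>

lemma variables_of_vanishing_parameters:
  fixes N :: "'a::comm_ring_1 mat_poly set"
  assumes k: "k \<ge> 2"
    and N: "ideal N (mpoly_ring (mat_vars (2 * k)))"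
    and sq: "\<And>z. z \<in> polys (mat_vars (2 * k)) \<Longrightarrow> z * z \<in> N \<Longrightarrow> z \<in> N"
    and diag: "\<And>i. i \<in> {1..2*k} \<Longrightarrow> comm_entry (2 * k) i i \<in> N"
    and anti: "\<And>i. i \<in> {1..2*k} \<Longrightarrow> comm_entry (2 * k) i (2 * k + 1 - i) \<in> N"
    and par: "parameters k \<subseteq> N"
    and v': "v \<in> mat_vars (2 * k)"
  shows "mvar v \<in> N"
proof -
  define XN where "XN i j \<longleftrightarrow> vx i j \<in> N" for i j
  define YN where "YN i j \<longleftrightarrow> vy i j \<in> N" for i j
  note isolate_x = isolate_x[OF N sq, folded XN_def YN_def]
  note isolate_y = isolate_y[OF N sq, folded XN_def YN_def]
  have X0: "i = k \<and> (j + 2 \<le> k \<or> j \<ge> k + 2) \<or> i = k + 1 \<and> (j \<le> k \<or> j = k + 2) \<or>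
      i = k + 2 \<and> (j + 1 = k \<or> j = k \<or> j = k + 1) \<or> i \<ge> k + 3 \<and> j = k"
    if "i \<in> {1..2*k}" "j \<in> {1..2*k}" "\<not> XN i j" for i j
  proof (rule not_Omega2[OF k that(1,2)])
    show "(i, j) \<notin> Omega2 k" using that(3) par parametersI(1) unfolding XN_def by blast
  qed
  have Y0: "j = k \<and> (i + 2 \<le> k \<or> i \<ge> k + 2) \<or> j = k + 1 \<and> (i \<le> k \<or> i = k + 2) \<or>
      j = k + 2 \<and> (i + 1 = k \<or> i = k \<or> i = k + 1) \<or> j \<ge> k + 3 \<and> i = k"
    if "i \<in> {1..2*k}" "j \<in> {1..2*k}" "\<not> YN i j" for i j
  proof (rule not_Omega2[OF k that(2,1)])
    show "(j, i) \<notin> Omega2 k" using that(3) par parametersI(2) unfolding YN_def by blast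
  qed
  note e = subsetD[OF par parametersI(3)] subsetD[OF par parametersI(4)] subsetD[OF par parametersI(5)]
    parametersI(6-)[THEN subsetD[OF par]]
  have a: "XN k s \<and> YN i k" if s: "1 \<le> s \<and> s + 2 \<le> k \<or> k + 3 \<le> s \<and> s \<le> 2 * k" "i + s = 2 * k + 1" for s i
  proof (rule isolate_y[of i s k])
    have i: "i \<in> {1..2*k}" "s = 2 * k + 1 - i" using s by auto
    show "comm_entry (2 * k) i s \<in> N" using anti[OF i(1)] unfolding i(2) .
    fix l assume l: "l \<in> {1..2*k}"
    have sr: "s \<in> {1..2*k}" using s by auto
    show "XN i l \<or> YN l s"
      using X0[OF i(1) l] Y0[OF l sr] s by linarith
    show "YN i l \<or> XN l s" if "l \<noteq> k"
      using Y0[OF i(1) l] X0[OF l sr] s that by linarith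
  next
    have "i = 2 * k + 1 - s" using s by auto
    then show "vx k s - vy i k \<in> N" using e(1)[of s] s(1) by auto
  qed (use s k in auto)
  have a1: "XN k j" if j: "1 \<le> j \<and> j + 2 \<le> k \<or> k + 3 \<le> j \<and> j \<le> 2 * k" for j
  proof -
    have "j \<le> 2 * k + 1" using j by auto
    then have "2 * k + 1 - j + j = 2 * k + 1" by (rule le_add_diff_inverse2)
    from a[OF j this] show ?thesis by (rule conjunct1)
  qed
  have a2: "YN i k" if i: "1 \<le> i \<and> i + 2 \<le> k \<or> k + 3 \<le> i \<and> i \<le> 2 * k" for i
  proof -
    have "i \<le> 2 * k + 1" using i by auto
    then obtain s where s: "i + s = 2 * k + 1" by (auto simp: le_iff_add)
    then have "1 \<le> s \<and> s + 2 \<le> k \<or> k + 3 \<le> s \<and> s \<le> 2 * k" using i by linarith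
    from a[OF this s] show ?thesis by (rule conjunct2)
  qed
  define h where "h = k - 1"
  have h: "h + 1 = k" "h \<ge> 1" using k by (auto simp: h_def)
  note e = e[folded h_def]
  have s: "XN (k + 1) (k + 2) \<and> YN h (k + 1)"
  proof (rule isolate_y)
    have i: "h \<in> {1..2*k}" "k + 2 \<in> {1..2*k}" "k + 2 = 2 * k + 1 - h" using h k by auto
    show "comm_entry (2 * k) h (k + 2) \<in> N" using anti[OF i(1)] unfolding i(3) .
    fix l assume l: "l \<in> {1..2*k}"
    show "XN h l \<or> YN l (k + 2)"
      using X0[OF i(1) l] h by linarith
    show "YN h l \<or> XN l (k + 2)" if "l \<noteq> k + 1"
      using Y0[OF i(1) l] X0[OF l i(2)] that h by linarith
  qed (use h k e in auto)
  have q: "XN (k + 1) h \<and> YN (k + 2) (k + 1)"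
  proof (rule isolate_y)
    have i: "k + 2 \<in> {1..2*k}" "h \<in> {1..2*k}" "h = 2 * k + 1 - (k + 2)" using h k by auto
    show "comm_entry (2 * k) (k + 2) h \<in> N" using anti[OF i(1)] unfolding i(3) .
    fix l assume l: "l \<in> {1..2*k}"
    show "XN (k + 2) l \<or> YN l h"
      using Y0[OF l i(2)] h by linarith
    show "YN (k + 2) l \<or> XN l h" if "l \<noteq> k + 1"
      using Y0[OF i(1) l] X0[OF l i(2)] that h by linarith
  qed (use h k e in auto)
  have X1: "i = k \<and> j = k + 2 \<or> i = k + 1 \<and> (j + 2 \<le> k \<or> j = k) \<or>
      i = k + 2 \<and> (j + 1 = k \<or> j = k \<or> j = k + 1) \<or> i \<ge> k + 3 \<and> j = k"
    if ij: "i \<in> {1..2*k}" "j \<in> {1..2*k}" "\<not> XN i j" for i j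
  proof -
    have "1 \<le> j" "j \<le> 2 * k" using ij(2) by auto
    then have f: "i = k \<Longrightarrow> k < j + 2 \<and> j < k + 3" "i = k + 1 \<Longrightarrow> j \<noteq> h" "i = k + 1 \<Longrightarrow> j \<noteq> k + 2"
      using a1[of j] s q ij(3) by (auto simp: not_le[symmetric])
    from X0[OF ij] show ?thesis
      by (elim disjE conjE) (use f h(1) in simp_all, linarith+)
  qed
  have Y1: "j = k \<and> i = k + 2 \<or> j = k + 1 \<and> (i + 2 \<le> k \<or> i = k) \<or>
      j = k + 2 \<and> (i + 1 = k \<or> i = k \<or> i = k + 1) \<or> j \<ge> k + 3 \<and> i = k"
    if ij: "i \<in> {1..2*k}" "j \<in> {1..2*k}" "\<not> YN i j" for i j
  proof -
    have "1 \<le> i" "i \<le> 2 * k" using ij(1) by auto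
    then have f: "j = k \<Longrightarrow> k < i + 2 \<and> i < k + 3" "j = k + 1 \<Longrightarrow> i \<noteq> h" "j = k + 1 \<Longrightarrow> i \<noteq> k + 2"
      using a2[of i] s q ij(3) by (auto simp: not_le[symmetric])
    from Y0[OF ij] show ?thesis
      by (elim disjE conjE) (use f h(1) in simp_all, linarith+)
  qed
  have b: "XN (k + 1) i \<and> YN i (k + 1)" if "1 \<le> i" "i + 2 \<le> k" for i
  proof (rule isolate_y)
    have i: "i \<in> {1..2*k}" using that by auto
    show "comm_entry (2 * k) i i \<in> N" by (rule diag[OF i])
    fix l assume l: "l \<in> {1..2*k}"
    show "XN i l \<or> YN l i" using X1[OF i l] that by linarith
    show "YN i l \<or> XN l i" if "l \<noteq> k + 1"
      using Y1[OF i l] X1[OF l i] that \<open>i + 2 \<le> k\<close> by linarith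
  qed (use that k e(2)[of i] in auto)
  have ee: "XN i k \<and> YN k i" if "k + 3 \<le> i" "i \<le> 2 * k" for i
  proof (rule isolate_x)
    have i: "i \<in> {1..2*k}" using that by auto
    show "comm_entry (2 * k) i i \<in> N" by (rule diag[OF i])
    fix l assume l: "l \<in> {1..2*k}"
    show "YN i l \<or> XN l i" using X1[OF l i] that by (cases "XN l i") auto
    show "XN i l \<or> YN l i" if "l \<noteq> k"
      using X1[OF i l] that \<open>k + 3 \<le> i\<close> by linarith
  qed (use that k e(3)[of i] in auto)
  have t: "XN (k + 2) h \<and> YN h (k + 2)"
  proof (rule isolate_y)
    have i: "h \<in> {1..2*k}" using h k by auto
    show "comm_entry (2 * k) h h \<in> N" by (rule diag[OF i])
    fix l assume l: "l \<in> {1..2*k}"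
    show "XN h l \<or> YN l h" using X1[OF i l] h by linarith
    show "YN h l \<or> XN l h" if "l \<noteq> k + 2"
      using Y1[OF i l] X1[OF l i] that h by linarith
  qed (use h k e in auto)
  have u: "XN (k + 2) k \<and> YN (k + 1) (k + 2)"
  proof (rule isolate_y)
    have i: "k + 1 \<in> {1..2*k}" "k \<in> {1..2*k}" "k = 2 * k + 1 - (k + 1)" using k by auto
    show "comm_entry (2 * k) (k + 1) k \<in> N" using anti[OF i(1)] by simp
    fix l assume l: "l \<in> {1..2*k}"
    show "XN (k + 1) l \<or> YN l k" using X1[OF i(1) l] Y1[OF l i(2)] by linarith
    show "YN (k + 1) l \<or> XN l k" if "l \<noteq> k + 2"
      using Y1[OF i(1) l] that by linarith
  qed (use k e in auto)
  have v: "XN (k + 2) (k + 1) \<and> YN k (k + 2)"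
  proof (rule isolate_y)
    have i: "k \<in> {1..2*k}" "k + 1 \<in> {1..2*k}" "k + 1 = 2 * k + 1 - k" using k by auto
    show "comm_entry (2 * k) k (k + 1) \<in> N" using anti[OF i(1)] unfolding i(3) .
    fix l assume l: "l \<in> {1..2*k}"
    show "XN k l \<or> YN l (k + 1)" using X1[OF i(1) l] Y1[OF l i(2)] by linarith
    show "YN k l \<or> XN l (k + 1)" if "l \<noteq> k + 2"
      using X1[OF l i(2)] that by linarith
  qed (use k e in auto)
  have X2: "i = k \<and> j = k + 2 \<or> i = k + 1 \<and> j = k"
    if ij: "i \<in> {1..2*k}" "j \<in> {1..2*k}" "\<not> XN i j" for i j
  proof -
    have "1 \<le> j" "i \<le> 2 * k" using ij(1,2) by auto
    then have f: "i = k + 1 \<Longrightarrow> \<not> j + 2 \<le> k" "j = k \<Longrightarrow> \<not> k + 3 \<le> i"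
      "i = k + 2 \<Longrightarrow> j \<noteq> h" "i = k + 2 \<Longrightarrow> j \<noteq> k" "i = k + 2 \<Longrightarrow> j \<noteq> k + 1"
      using b[of j] ee[of i] t u v ij(3) by auto
    from X1[OF ij] show ?thesis
      by (elim disjE conjE) (use f h(1) in simp_all, linarith?)
  qed
  have Y2: "j = k \<and> i = k + 2 \<or> j = k + 1 \<and> i = k"
    if ij: "i \<in> {1..2*k}" "j \<in> {1..2*k}" "\<not> YN i j" for i j
  proof -
    have "1 \<le> i" "j \<le> 2 * k" using ij(1,2) by auto
    then have f: "j = k + 1 \<Longrightarrow> \<not> i + 2 \<le> k" "i = k \<Longrightarrow> \<not> k + 3 \<le> j"
      "j = k + 2 \<Longrightarrow> i \<noteq> h" "j = k + 2 \<Longrightarrow> i \<noteq> k" "j = k + 2 \<Longrightarrow> i \<noteq> k + 1"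
      using b[of i] ee[of j] t u v ij(3) by auto
    from Y1[OF ij] show ?thesis
      by (elim disjE conjE) (use f h(1) in simp_all, linarith?)
  qed
  have p: "XN k (k + 2) \<and> YN (k + 2) k"
  proof (rule isolate_y)
    have i: "k + 2 \<in> {1..2*k}" using k by auto
    show "comm_entry (2 * k) (k + 2) (k + 2) \<in> N" by (rule diag[OF i])
    fix l assume l: "l \<in> {1..2*k}"
    show "XN (k + 2) l \<or> YN l (k + 2)" using X2[OF i l] by linarith
    show "YN (k + 2) l \<or> XN l (k + 2)" if "l \<noteq> k"
      using X2[OF l i] that by linarith
  qed (use k e in auto)
  have r: "XN (k + 1) k \<and> YN k (k + 1)"
  proof (rule isolate_x)
    have i: "k + 1 \<in> {1..2*k}" using k by auto
    show "comm_entry (2 * k) (k + 1) (k + 1) \<in> N" by (rule diag[OF i])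
    fix l assume l: "l \<in> {1..2*k}"
    show "YN (k + 1) l \<or> XN l (k + 1)" using X2[OF l i] by linarith
    show "XN (k + 1) l \<or> YN l (k + 1)" if "l \<noteq> k"
      using X2[OF i l] that by linarith
  qed (use k e in auto)
  have all: "XN i j \<and> YN i j" if "i \<in> {1..2*k}" "j \<in> {1..2*k}" for i j
  proof
    show "XN i j" using X2[OF that] p r by (cases "XN i j") auto
    show "YN i j" using Y2[OF that] p r by (cases "YN i j") auto
  qed
  from v' obtain i j where "i \<in> {1..2*k}" "j \<in> {1..2*k}" "v = XVar i j \<or> v = YVar i j"
    unfolding mat_vars_def by blast
  then show ?thesis using all[of i j] unfolding XN_def YN_def vx_def vy_def by blast
qed

section \<open>The number of parameters\<close>

text \<open>
  In the union that defines \<open>Omega2\<close> the position \<open>(k + 2, k + 2)\<close> occurs twice; it is counted once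
  here, which is what makes the bound sharp.
\<close>

lemma card_Omega2:
  assumes k: "k \<ge> 2"
  shows "finite (Omega2 k)" "card (Omega2 k) + (4 * k - 1) \<le> 4 * k * k"
proof -
  define S1 where "S1 = {1..k-1} \<times> {1..2*k}"
  define S2 where "S2 = {k} \<times> {k-1..k+1}"
  define S3 where "S3 = {k+1} \<times> {k+1}"
  define S4 where "S4 = {k+1} \<times> {k+3..2*k}"
  define S5 where "S5 = {k+2} \<times> {1..k-2}"
  define S6 where "S6 = {k+2} \<times> {k+2..2*k}"
  define S7 where "S7 = {k+3..2*k} \<times> {1..k-1}"
  define S8 where "S8 = {k+3..2*k} \<times> {k+1..2*k}"
  note S_defs = S1_def S2_def S3_def S4_def S5_def S6_def S7_def S8_def
  define S where "S = [S1, S2, S3, S4, S5, S6, S7, S8]"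
  have c1: "{(i, j). 1 \<le> i \<and> i \<le> k - 1 \<and> 1 \<le> j \<and> j \<le> 2 * k} \<subseteq> S1"
    unfolding S1_def using k by auto
  have c2: "{(k, j) | j. k - 1 \<le> j \<and> j \<le> k + 1} \<subseteq> S2"
    unfolding S2_def using k by auto
  have c3: "{(k + 1, k + 1), (k + 2, k + 2)} \<subseteq> S3 \<union> S6"
    unfolding S3_def S6_def using k by auto
  have c4: "{(k + 1, j) | j. k + 3 \<le> j \<and> j \<le> 2 * k} \<subseteq> S4"
    unfolding S4_def using k by auto
  have c5: "{(k + 2, j) | j. 1 \<le> j \<and> j \<le> k - 2} \<subseteq> S5"
    unfolding S5_def using k by auto
  have c6: "{(k + 2, j) | j. k + 2 \<le> j \<and> j \<le> 2 * k} \<subseteq> S6"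
    unfolding S6_def using k by auto
  have c7: "{(i, j). k + 3 \<le> i \<and> i \<le> 2 * k \<and> 1 \<le> j \<and> j \<le> k - 1} \<subseteq> S7"
    unfolding S7_def using k by auto
  have c8: "{(i, j). k + 3 \<le> i \<and> i \<le> 2 * k \<and> k + 1 \<le> j \<and> j \<le> 2 * k} \<subseteq> S8"
    unfolding S8_def using k by auto
  have "Omega2 k \<subseteq> S1 \<union> S2 \<union> (S3 \<union> S6) \<union> S4 \<union> S5 \<union> S6 \<union> S7 \<union> S8"
    unfolding Omega2_def by (intro Un_mono c1 c2 c3 c4 c5 c6 c7 c8)
  also have "\<dots> \<subseteq> \<Union>(set S)"
    unfolding S_def by (simp only: list.set Union_insert) blast
  finally have sub: "Omega2 k \<subseteq> \<Union>(set S)" .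
  have fin: "finite (\<Union>(set S))" unfolding S_def S_defs by simp
  show "finite (Omega2 k)" by (rule finite_subset[OF sub fin])
  have "card (\<Union>(set B)) \<le> sum_list (map card B)" for B :: "(nat \<times> nat) set list"
  proof (induction B)
    case (Cons b B)
    then show ?case using card_Un_le[of b "\<Union>(set B)"] by simp
  qed simp
  from this[of S] have le: "card (Omega2 k) \<le> sum_list (map card S)"
    using card_mono[OF fin sub] by (rule order_trans[rotated])
  obtain m where m: "k = m + 2" using k by (metis le_add_diff_inverse2)
  have "sum_list (map card S) + (4 * k - 1) = 4 * k * k"
    unfolding S_def S_defs m by (simp add: card_cartesian_product algebra_simps)
  then show "card (Omega2 k) + (4 * k - 1) \<le> 4 * k * k"
    using le by linarith
qed

text \<open>
  Each of the \<open>4 * k - 1\<close> positions outside \<open>Omega2\<close> contributes one difference, and each position in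
  \<open>Omega2\<close> two variables. An upper bound suffices, because the dimension is at most the number of
  parameters and at least this bound.
\<close>

lemma card_parameters_le:
  assumes k: "k \<ge> 2"
  shows "card (parameters k :: 'a::comm_ring_1 mat_poly set) \<le> 2 * (2 * k) * (2 * k) - (2 * (2 * k) - 1)"
proof -
  define W where "W = (\<lambda>(i, j). vx i j :: 'a mat_poly) ` Omega2 k"
  define W' where "W' = (\<lambda>(i, j). vy j i :: 'a mat_poly) ` Omega2 k"
  define A where "A = (\<lambda>s. vx k s - vy (2 * k + 1 - s) k :: 'a mat_poly) ` ({1..k-2} \<union> {k+3..2*k})"
  define B where "B = (\<lambda>s. vx (k + 1) s - vy s (k + 1) :: 'a mat_poly) ` {1..k-2}"
  define E where "E = (\<lambda>s. vx s k - vy k s :: 'a mat_poly) ` {k+3..2*k}"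
  define Z where "Z = set [vx k (k + 2) - vy (k + 2) k,
      vx (k + 1) (k - 1) - vy (k + 2) (k + 1),
      vx (k + 1) k - vy k (k + 1),
      vx (k + 1) (k + 2) - vy (k - 1) (k + 1),
      vx (k + 2) (k - 1) - vy (k - 1) (k + 2),
      vx (k + 2) k - vy (k + 1) (k + 2),
      vx (k + 2) (k + 1) - vy k (k + 2) :: 'a mat_poly]"
  have eq: "parameters k = W \<union> W' \<union> A \<union> B \<union> E \<union> Z"
    unfolding parameters_def W_def W'_def A_def B_def E_def Z_def
    by (intro arg_cong2[where f = "(\<union>)"]) (force simp: image_iff)+
  have "card W \<le> card (Omega2 k)" "card W' \<le> card (Omega2 k)"
    unfolding W_def W'_def by (rule card_image_le[OF card_Omega2(1)[OF k]])+
  moreover have "card A \<le> 2 * (k - 2)"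
  proof -
    have "card A \<le> card ({1..k-2} \<union> {k+3..2*k})" unfolding A_def by (rule card_image_le) simp
    also have "\<dots> \<le> 2 * (k - 2)" using card_Un_le[of "{1..k-2}" "{k+3..2*k}"] by simp
    finally show ?thesis .
  qed
  moreover have "card B \<le> k - 2" "card E \<le> k - 2"
    unfolding B_def E_def
    using card_image_le[of "{1..k-2}"] card_image_le[of "{k+3..2*k}"] by fastforce+
  moreover have "card Z \<le> 7" unfolding Z_def by (rule order_trans[OF card_length]) simp
  moreover have "card (parameters k :: 'a mat_poly set) \<le> card W + card W' + card A + card B + card E + card Z"
    unfolding eq by (meson card_Un_le add_le_mono1 order_trans)
  moreover have "2 * (2 * k) * (2 * k) = 2 * (4 * k * k)" by simp
  ultimately show ?thesis using card_Omega2(2)[OF k] k by linarith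
qed

lemma Omega2_range: "k \<ge> 2 \<Longrightarrow> (i, j) \<in> Omega2 k \<Longrightarrow> i \<in> {1..2*k} \<and> j \<in> {1..2*k}"
  unfolding Omega2_def by auto

lemma homogeneous_vx: "homogeneous 1 (vx i j)" and homogeneous_vy: "homogeneous 1 (vy i j)"
  by (simp_all only: vx_def vy_def homogeneous_mvar)

lemma parameters_linear:
  fixes f :: "'a::comm_ring_1 mat_poly"
  assumes "k \<ge> 2" "f \<in> parameters k"
  shows "f \<in> polys (mat_vars (2 * k))" and "homogeneous 1 f"
proof -
  define L where "L = {f :: 'a mat_poly. f \<in> polys (mat_vars (2 * k)) \<and> homogeneous 1 f}"
  have x: "vx i j \<in> L" and y: "vy i j \<in> L" if "1 \<le> i" "i \<le> 2 * k" "1 \<le> j" "j \<le> 2 * k" for i j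
    using that homogeneous_vx homogeneous_vy by (auto simp: L_def)
  have d: "f - g \<in> L" if "f \<in> L" "g \<in> L" for f g
    using that by (auto simp: L_def intro: homogeneous_diff)
  have "{vx i j | i j. (i, j) \<in> Omega2 k} \<subseteq> L" "{vy j i | i j. (i, j) \<in> Omega2 k} \<subseteq> L"
    using Omega2_range[OF assms(1)] x y by fastforce+
  moreover have "{vx k s - vy (2 * k + 1 - s) k | s. 1 \<le> s \<and> s \<le> k - 2 \<or> k + 3 \<le> s \<and> s \<le> 2 * k} \<subseteq> L"
    using assms(1) by (auto intro!: d x y)
  moreover have "{vx (k + 1) s - vy s (k + 1) | s. 1 \<le> s \<and> s \<le> k - 2} \<subseteq> L"
    "{vx s k - vy k s | s. k + 3 \<le> s \<and> s \<le> 2 * k} \<subseteq> L"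
    using assms(1) by (auto intro!: d x y)
  moreover have "{vx k (k + 2) - vy (k + 2) k,
      vx (k + 1) (k - 1) - vy (k + 2) (k + 1),
      vx (k + 1) k - vy k (k + 1),
      vx (k + 1) (k + 2) - vy (k - 1) (k + 1),
      vx (k + 2) (k - 1) - vy (k - 1) (k + 2),
      vx (k + 2) k - vy (k + 1) (k + 2),
      vx (k + 2) (k + 1) - vy k (k + 2)} \<subseteq> L"
    using assms(1) by (intro insert_subsetI empty_subsetI d x y) auto
  ultimately have "parameters k \<subseteq> L"
    unfolding parameters_def by (intro Un_least)
  then show "f \<in> polys (mat_vars (2 * k))" "homogeneous 1 f"
    using assms(2) by (auto simp: L_def)
qed

theorem theorem2p3:
  fixes k n :: nat and fs :: "'a::field mat_poly list"
  assumes "n = 2 * k" and "k \<ge> 2" and "CHAR('a) = 2"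
    and "set fs = parameters k" and "distinct fs"
  shows "hsop (mat_vars n) (diag_antidiag_ideal n)
           (map (\<lambda>f. diag_antidiag_ideal n +>\<^bsub>mpoly_ring (mat_vars n)\<^esub> f) fs)"
proof -
  note k = \<open>k \<ge> 2\<close> and n = \<open>n = 2 * k\<close> and fs = \<open>set fs = parameters k\<close>
  let ?V = "mat_vars n"
  define G where "G = {comm_entry n i i :: 'a mat_poly | i. i \<in> {1..n}} \<union> {comm_entry n i (n + 1 - i) | i. i \<in> {1..n}}"
  have ideal: "diag_antidiag_ideal n = Idl\<^bsub>mpoly_ring ?V\<^esub> G"
    unfolding diag_antidiag_ideal_def G_def ..
  have finV: "finite ?V" by (simp add: mat_vars_eq xvars_def yvars_def)
  have finG: "finite G" by (simp add: G_def)
  have GV: "G \<subseteq> polys ?V" unfolding G_def by (auto intro!: comm_entry_polys)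
  have Ghom: "\<exists>d>0. homogeneous d g" if "g \<in> G" for g
    using that homogeneous_comm_entry unfolding G_def by (intro exI[of _ 2]) auto
  have fsV: "set fs \<subseteq> polys ?V" using parameters_linear(1)[OF k] fs n by blast
  have fshom: "\<exists>d>0. homogeneous d f" if "f \<in> set fs" for f
    using parameters_linear(2)[OF k] that fs by (intro exI[of _ 1]) simp
  let ?J = "Idl\<^bsub>mpoly_ring ?V\<^esub> (G \<union> set fs)"
  have GfsV: "G \<union> set fs \<subseteq> polys ?V" using GV fsV by simp
  have J: "ideal ?J (mpoly_ring ?V)" by (rule ideal_genideal_mpoly[OF GfsV])
  define N where "N = {f \<in> polys ?V. \<exists>m. f ^ m \<in> ?J}"
  have NI: "ideal N (mpoly_ring ?V)" unfolding N_def by (rule ideal_radical[OF J])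
  have JN: "f \<in> N" if "f \<in> G \<union> set fs" for f
    using genideal_mpoly_self[OF GfsV that] GfsV that unfolding N_def by (auto intro!: exI[of _ 1])
  have sq: "z \<in> N" if z: "z \<in> polys ?V" "z * z \<in> N" for z
  proof -
    obtain m where "(z * z) ^ m \<in> ?J" using z(2) unfolding N_def by blast
    then have "z ^ (2 * m) \<in> ?J" by (simp only: power_mult power2_eq_square)
    then show ?thesis using z(1) unfolding N_def by blast
  qed
  have nil: "\<exists>m. mvar v ^ m \<in> ?J" if v: "v \<in> ?V" for v
  proof -
    have "mvar v \<in> N"
    proof (rule variables_of_vanishing_parameters[OF k, folded n])
      show "comm_entry n i i \<in> N" if "i \<in> {1..n}" for i
        using that JN unfolding G_def by blast
      show "comm_entry n i (n + 1 - i) \<in> N" if "i \<in> {1..n}" for i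
        using that JN unfolding G_def by blast
      show "parameters k \<subseteq> N" using JN fs by blast
      show "z \<in> N" if "z \<in> polys ?V" "z * z \<in> N" for z
        using that by (rule sq)
      show "ideal N (mpoly_ring ?V)" by (rule NI)
      show "v \<in> ?V" by (rule v)
    qed
    then show ?thesis unfolding N_def by blast
  qed
  have "length fs = card (parameters k :: 'a mat_poly set)"
    using distinct_card[OF \<open>distinct fs\<close>] fs by simp
  then have "length fs \<le> 2 * n * n - (2 * n - 1)"
    using card_parameters_le[OF k, where 'a = 'a] n by simp
  moreover have "ereal (real (2 * n * n - (2 * n - 1))) \<le> krull_dim (mpoly_ring ?V Quot Idl\<^bsub>mpoly_ring ?V\<^esub> G)"
    using krull_dim_diag_antidiag_ge[of n, where 'a = 'a] k n unfolding ideal by simp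
  ultimately have "ereal (real (length fs)) \<le> krull_dim (mpoly_ring ?V Quot Idl\<^bsub>mpoly_ring ?V\<^esub> G)"
    by (meson ereal_less_eq(3) of_nat_le_iff order_trans)
  then show ?thesis
    unfolding ideal
    by (intro hsop_of_nilpotent_variables[OF finV finG GV Ghom \<open>distinct fs\<close> fsV fshom nil])
qed

end
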